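(* Let $p$ be a prime with $p\equiv 1 \pmod 4$. For each positive integer $n$ and each nonnegative integer $k$: \begin{itemize} \item $\mathrm{diag}(\lambda)\oplus\mathrm{diag}(0^{k})$ can be embedded in $\mathrm{diag}(1^{n-1},\lambda)$ if and only if $k \leq \frac{n-1}{2}$; \item for each $S$ among $\mathrm{diag}(1)$, $\mathrm{diag}(1,\lambda)$: $S\oplus\mathrm{diag}(0^{k})$ can be embedded in $\mathrm{diag}(1^{n-1},\lambda)$ if and only if $k \leq \frac{n-2}{2}$; \item for each $S$ among $\mathrm{diag}(p)$, $\mathrm{diag}(\lambda p)$, $\mathrm{diag}(1,1)$, $\mathrm{diag}(\lambda,p)$, $\mathrm{diag}(\lambda,\lambda p)$, $\mathrm{diag}(1,1,\lambda)$: $S\oplus\mathrm{diag}(0^{k})$ can be embedded in $\mathrm{diag}(1^{n-1},\lambda)$ if and only if $k \leq \frac{n-3}{2}$; \item for each $S$ among $\mathrm{diag}(1,p)$, $\mathrm{diag}(1,\lambda p)$, $\mathrm{diag}(1,1,1)$, $\mathrm{diag}(1,\lambda,p)$, $\mathrm{diag}(1,\lambda,\lambda p)$: $S\oplus\mathrm{diag}(0^{k})$ can be embedded in $\mathrm{diag}(1^{n-1},\lambda)$ if and only if $k \leq \frac{n-4}{2}$; \item for each $S$ among $\mathrm{diag}(p,\lambda p)$, $\mathrm{diag}(1,1,p)$, $\mathrm{diag}(1,1,\lambda p)$, $\mathrm{diag}(\lambda,p,\lambda p)$: $S\oplus\mathrm{diag}(0^{k})$ can be embedded in $\mathrm{diag}(1^{n-1},\lambda)$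 if and only if $k \leq \frac{n-5}{2}$; \item $\mathrm{diag}(1,p,\lambda p)\oplus\mathrm{diag}(0^{k})$ can be embedded in $\mathrm{diag}(1^{n-1},\lambda)$ if and only if $k \leq \frac{n-6}{2}$. \end{itemize}
   Context: A quadratic space over $\mathbb{Q}_p$ is a finite-dimensional $\mathbb{Q}_p$-vector space with a (possibly degenerate) quadratic form. For $a_1,\dots,a_n \in \mathbb{Q}_p$, $\mathrm{diag}(a_1,\dots,a_n)$ denotes $\mathbb{Q}_p^n$ with the form $a_1x_1^2+\cdots+a_nx_n^2$; an entry $a^k$ means $a$ repeated $k$ times, so $\mathrm{diag}(1^{n-1},\lambda)$ is $(\mathbb{Q}_p^n, x_1^2+\cdots+x_{n-1}^2+\lambda x_n^2)$. $\oplus$ is the orthogonal direct sum. A quadratic space $(V,Q)$ can be embedded in $(V',Q')$ if there is an injective linear map $f:V\to V'$ with $Q'(f(v))=Q(v)$ for all $v\in V$. $\lambda$ denotes a fixed nonsquare of $\mathbb{F}_p$, regarded in $\mathbb{Q}_p$ as a unit $\lambda\in\mathbb{Z}_p^\times$ whose reduction modulo $p$ is a nonsquare in $\mathbb{F}_p$, so that $\mathbb{Q}_p^\times/(\mathbb{Q}_p^\times)^2=\{1,\lambda,p,\lambda p\}$. *)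

theory Defs
  imports
    "HOL-Number_Theory.Cong"
    "HOL-Computational_Algebra.Polynomial_Factorial"
    "Berlekamp_Zassenhaus.Finite_Field"
    "Jordan_Normal_Form.VS_Connect"
begin

section \<open>The p-adic integers and the p-adic numbers\<close>

text \<open>
  The prime is carried by a type of class \<^class>\<open>prime_card\<close>: p is \<open>CARD('p)\<close>.
  The p-adic integers are the inverse limit of the rings Z/p^nZ, where a class modulo p^n is
  represented by its least nonnegative residue. The n-th component of an element is its class
  modulo p^n (so component 0 carries no information).
\<close>

typedef (overloaded) ('p::prime_card) padic_int =
  "{x :: nat \<Rightarrow> int. \<forall>m n. m \<le> n \<longrightarrow> x n mod int CARD('p) ^ m = x m}"
  morphisms padic_component Abs_padic_int
  by (rule exI[of _ "\<lambda>_. 0"]) simp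

setup_lifting type_definition_padic_int

lemma mod_power_mod_power:
  fixes a p :: int
  assumes "m \<le> n"
  shows "a mod p ^ n mod p ^ m = a mod p ^ m"
  using assms by (simp add: le_imp_power_dvd mod_mod_cancel)

instantiation padic_int :: (prime_card) comm_ring_1
begin

lift_definition zero_padic_int :: "'a padic_int" is "\<lambda>_. 0"
  by simp

lift_definition one_padic_int :: "'a padic_int" is "\<lambda>n. 1 mod int CARD('a) ^ n"
  by (simp add: mod_power_mod_power)

lift_definition plus_padic_int :: "'a padic_int \<Rightarrow> 'a padic_int \<Rightarrow> 'a padic_int"
  is "\<lambda>x y n. (x n + y n) mod int CARD('a) ^ n"
proof -
  fix x y :: "nat \<Rightarrow> int" and m n :: nat
  assume x: "\<And>m n. m \<le> n \<Longrightarrow> x n mod int CARD('a) ^ m = x m"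
    and y: "\<And>m n. m \<le> n \<Longrightarrow> y n mod int CARD('a) ^ m = y m" and mn: "m \<le> n"
  have "(x n + y n) mod int CARD('a) ^ n mod int CARD('a) ^ m
      = (x n + y n) mod int CARD('a) ^ m"
    using mn by (rule mod_power_mod_power)
  also have "\<dots> = ((x n mod int CARD('a) ^ m) + (y n mod int CARD('a) ^ m)) mod int CARD('a) ^ m"
    by (rule mod_add_eq [symmetric])
  also have "\<dots> = (x m + y m) mod int CARD('a) ^ m"
    using x y mn by simp
  finally show "(x n + y n) mod int CARD('a) ^ n mod int CARD('a) ^ m
      = (x m + y m) mod int CARD('a) ^ m" .
qed

lift_definition times_padic_int :: "'a padic_int \<Rightarrow> 'a padic_int \<Rightarrow> 'a padic_int"
  is "\<lambda>x y n. (x n * y n) mod int CARD('a) ^ n"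
proof -
  fix x y :: "nat \<Rightarrow> int" and m n :: nat
  assume x: "\<And>m n. m \<le> n \<Longrightarrow> x n mod int CARD('a) ^ m = x m"
    and y: "\<And>m n. m \<le> n \<Longrightarrow> y n mod int CARD('a) ^ m = y m" and mn: "m \<le> n"
  have "(x n * y n) mod int CARD('a) ^ n mod int CARD('a) ^ m
      = (x n * y n) mod int CARD('a) ^ m"
    using mn by (rule mod_power_mod_power)
  also have "\<dots> = ((x n mod int CARD('a) ^ m) * (y n mod int CARD('a) ^ m)) mod int CARD('a) ^ m"
    by (rule mod_mult_eq [symmetric])
  also have "\<dots> = (x m * y m) mod int CARD('a) ^ m"
    using x y mn by simp
  finally show "(x n * y n) mod int CARD('a) ^ n mod int CARD('a) ^ m
      = (x m * y m) mod int CARD('a) ^ m" .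
qed

lift_definition uminus_padic_int :: "'a padic_int \<Rightarrow> 'a padic_int"
  is "\<lambda>x n. (- x n) mod int CARD('a) ^ n"
proof -
  fix x :: "nat \<Rightarrow> int" and m n :: nat
  assume x: "\<And>m n. m \<le> n \<Longrightarrow> x n mod int CARD('a) ^ m = x m" and mn: "m \<le> n"
  have "(- x n) mod int CARD('a) ^ n mod int CARD('a) ^ m = (- x n) mod int CARD('a) ^ m"
    using mn by (rule mod_power_mod_power)
  also have "\<dots> = (- (x n mod int CARD('a) ^ m)) mod int CARD('a) ^ m"
    by (rule mod_minus_eq [symmetric])
  also have "\<dots> = (- x m) mod int CARD('a) ^ m"
    using x mn by simp
  finally show "(- x n) mod int CARD('a) ^ n mod int CARD('a) ^ m
      = (- x m) mod int CARD('a) ^ m" .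
qed

definition minus_padic_int :: "'a padic_int \<Rightarrow> 'a padic_int \<Rightarrow> 'a padic_int"
  where "x - y = x + (- y :: 'a padic_int)"

instance
proof
  fix a b c :: "'a padic_int"
  have self: "x n mod int CARD('a) ^ n = x n"
    if "\<forall>m n. m \<le> n \<longrightarrow> x n mod int CARD('a) ^ m = x m" for x :: "nat \<Rightarrow> int" and n
    using that by blast
  show "a + b + c = a + (b + c)"
    by transfer (simp add: mod_simps add.assoc)
  show "a + b = b + a"
    by transfer (simp add: add.commute)
  show "0 + a = a"
    by transfer (simp add: self)
  show "- a + a = 0"
    by transfer (simp add: mod_simps)
  show "a - b = a + - b"
    by (simp add: minus_padic_int_def)
  show "a * b * c = a * (b * c)"
    by transfer (simp add: mod_simps mult.assoc)
  show "a * b = b * a"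
    by transfer (simp add: mult.commute)
  show "1 * a = a"
    by transfer (simp add: mod_simps self)
  show "(a + b) * c = a * c + b * c"
    by transfer (simp add: mod_simps distrib_right)
  have "1 mod int CARD('a) ^ 1 = 1"
    using prime_gt_1_int[OF prime_card_int[where 'a = 'a]] by simp
  then show "(0 :: 'a padic_int) \<noteq> 1"
    by transfer (metis zero_neq_one)
qed

end

instance padic_int :: (prime_card) idom
proof
  fix a b :: "'a padic_int"
  let ?p = "int CARD('a)"
  let ?x = "padic_component a" and ?y = "padic_component b"
  have x: "?x n mod ?p ^ m = ?x m" and y: "?y n mod ?p ^ m = ?y m" if "m \<le> n" for m n
    using padic_component[of a] padic_component[of b] that by blast+
  assume "a \<noteq> 0" and "b \<noteq> 0"
  then have "?x \<noteq> (\<lambda>_. 0)" and "?y \<noteq> (\<lambda>_. 0)"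
    by (simp_all add: padic_component_inject [symmetric] zero_padic_int.rep_eq)
  then obtain i j where i: "?x i \<noteq> 0" and j: "?y j \<noteq> 0"
    by blast
  have p: "prime_elem ?p"
    using prime_card_int[where 'a = 'a] by (rule prime_imp_prime_elem)
  have nd: "\<not> ?p ^ i dvd ?x (i + j)" "\<not> ?p ^ j dvd ?y (i + j)"
    using x[of i "i + j"] y[of j "i + j"] i j by (auto simp: dvd_eq_mod_eq_0)
  then have nz: "?x (i + j) \<noteq> 0" "?y (i + j) \<noteq> 0"
    by auto
  have "multiplicity ?p (?x (i + j)) < i" "multiplicity ?p (?y (i + j)) < j"
    using nd multiplicity_dvd'[of i ?p "?x (i + j)"] multiplicity_dvd'[of j ?p "?y (i + j)"]
    by (auto simp: not_less [symmetric])
  then have "multiplicity ?p (?x (i + j) * ?y (i + j)) < i + j"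
    using prime_elem_multiplicity_mult_distrib[OF p nz] by linarith
  then have "\<not> ?p ^ (i + j) dvd ?x (i + j) * ?y (i + j)"
    using power_dvd_iff_le_multiplicity[of "?x (i + j) * ?y (i + j)" ?p "i + j"] nz
      prime_elem_not_unit[OF p]
    by (metis linorder_not_le mult_eq_0_iff)
  then have "padic_component (a * b) (i + j) \<noteq> 0"
    by (simp only: times_padic_int.rep_eq dvd_eq_mod_eq_0 not_False_eq_True)
  then show "a * b \<noteq> 0"
    by (auto simp: zero_padic_int.rep_eq)
qed

type_synonym 'p padic = "'p padic_int fract"

definition padic_reduce :: "'p::prime_card padic_int \<Rightarrow> 'p mod_ring"
  where "padic_reduce x = of_int (padic_component x 1)"


section \<open>Quadratic spaces\<close>

record ('a, 'v) quad_space = "('a, 'v) module" +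
  form :: "'v \<Rightarrow> 'a"

locale quadratic_space = vectorspace class_ring V
  for V :: "('a::field, 'v, 'm) quad_space_scheme" (structure) +
  assumes finite_dimensional: "fin_dim"
    and form_smult: "v \<in> carrier V \<Longrightarrow> form V (c \<odot> v) = c\<^sup>2 * form V v"
    and polar_add: "\<lbrakk>u \<in> carrier V; v \<in> carrier V; w \<in> carrier V\<rbrakk> \<Longrightarrow>
      form V (u \<oplus> v \<oplus> w) - form V (u \<oplus> v) - form V w =
      (form V (u \<oplus> w) - form V u - form V w) + (form V (v \<oplus> w) - form V v - form V w)"
    and polar_smult: "\<lbrakk>v \<in> carrier V; w \<in> carrier V\<rbrakk> \<Longrightarrow>
      form V (c \<odot> v \<oplus> w) - form V (c \<odot> v) - form V w =
      c * (form V (v \<oplus> w) - form V v - form V w)"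

definition diag :: "'a::field list \<Rightarrow> ('a, 'a vec) quad_space"
  where "diag as = module.extend (module_vec TYPE('a) (length as))
    \<lparr>form = \<lambda>v. \<Sum>i<length as. as ! i * (v $ i)\<^sup>2\<rparr>"

definition orth_sum ::
    "('a::field, 'v) quad_space \<Rightarrow> ('a, 'w) quad_space \<Rightarrow> ('a, 'v \<times> 'w) quad_space"
    (infixr \<open>\<oplus>\<^sub>q\<close> 65)
  where "V \<oplus>\<^sub>q W = module.extend (direct_sum V W)
    \<lparr>form = \<lambda>(v, w). form V v + form W w\<rparr>"

definition embeds :: "('a::field, 'v) quad_space \<Rightarrow> ('a, 'w) quad_space \<Rightarrow> bool"
    (infix \<open>embeds'_in\<close> 50)
  where "V embeds_in W \<longleftrightarrow>
    (\<exists>f \<in> module_hom class_ring V W.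
      inj_on f (carrier V) \<and> (\<forall>v \<in> carrier V. form W (f v) = form V v))"

lemma quad_space_sel_extend [simp]:
  "carrier (module.extend M r) = carrier M"
  "zero (module.extend M r) = zero M"
  "add (module.extend M r) = add M"
  "module.smult (module.extend M r) = module.smult M"
  "form (module.extend M \<lparr>form = q\<rparr>) = q"
  by (simp_all add: module.extend_def)

lemma module_extend_iff: "Module.module R (module.extend M r) \<longleftrightarrow> Module.module R M"
  by (simp add: Module.module_def module_axioms_def abelian_group_def abelian_monoid_def
      abelian_group_axioms_def comm_group_def group_def group_axioms_def Group.comm_monoid_def
      comm_monoid_axioms_def Group.monoid_def Units_def)

lemma submodule_extend_iff: "submodule R N (module.extend M r) \<longleftrightarrow> submodule R N M"
  by (simp add: submodule_def module_extend_iff)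

lemma vectorspace_extend_iff: "vectorspace K (module.extend V r) \<longleftrightarrow> vectorspace K V"
  by (simp add: vectorspace_def module_extend_iff)

lemma fin_dim_iff_submodule:
  assumes "vectorspace K V"
  shows "vectorspace.fin_dim K V \<longleftrightarrow>
    (\<exists>A. finite A \<and> A \<subseteq> carrier V \<and> (\<forall>N. submodule K N V \<longrightarrow> A \<subseteq> N \<longrightarrow> carrier V \<subseteq> N))"
proof -
  interpret vectorspace K V by (fact assms)
  have gen_iff: "span A = carrier V \<longleftrightarrow> (\<forall>N. submodule K N V \<longrightarrow> A \<subseteq> N \<longrightarrow> carrier V \<subseteq> N)"
    if "A \<subseteq> carrier V" for A
  proof (intro iffI allI impI)
    fix N assume "span A = carrier V" "submodule K N V" "A \<subseteq> N"
    then show "carrier V \<subseteq> N"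
      using span_is_subset[of A N] by simp
  next
    assume "\<forall>N. submodule K N V \<longrightarrow> A \<subseteq> N \<longrightarrow> carrier V \<subseteq> N"
    then show "span A = carrier V"
      using span_is_subset2[OF that] span_is_submodule[OF that] in_own_span[OF that]
      by (intro equalityI) simp_all
  qed
  show ?thesis
    unfolding fin_dim_def by (intro ex_cong1 conj_cong refl gen_iff)
qed

lemma fin_dim_extend_iff:
  assumes "vectorspace K V"
  shows "vectorspace.fin_dim K (module.extend V r) \<longleftrightarrow> vectorspace.fin_dim K V"
  using assms
  by (simp add: fin_dim_iff_submodule vectorspace_extend_iff submodule_extend_iff)

lemma fin_dim_direct_sum:
  assumes V: "vectorspace K V" and W: "vectorspace K W"
    and fV: "vectorspace.fin_dim K V" and fW: "vectorspace.fin_dim K W"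
  shows "vectorspace.fin_dim K (direct_sum V W)"
proof -
  interpret V: vectorspace K V by (fact V)
  interpret W: vectorspace K W by (fact W)
  obtain A where A: "finite A" "A \<subseteq> carrier V"
      "\<And>N. submodule K N V \<Longrightarrow> A \<subseteq> N \<Longrightarrow> carrier V \<subseteq> N"
    using fV fin_dim_iff_submodule[OF V] by auto
  obtain B where B: "finite B" "B \<subseteq> carrier W"
      "\<And>N. submodule K N W \<Longrightarrow> B \<subseteq> N \<Longrightarrow> carrier W \<subseteq> N"
    using fW fin_dim_iff_submodule[OF W] by auto
  let ?S = "A \<times> {\<zero>\<^bsub>W\<^esub>} \<union> {\<zero>\<^bsub>V\<^esub>} \<times> B"
  have gen: "carrier (direct_sum V W) \<subseteq> N" if N: "submodule K N (direct_sum V W)" "?S \<subseteq> N" for N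
  proof -
    have add: "(v \<oplus>\<^bsub>V\<^esub> v', w \<oplus>\<^bsub>W\<^esub> w') \<in> N" if "(v, w) \<in> N" "(v', w') \<in> N" for v v' w w'
      using submodule.m_closed[OF N(1) that] by (simp add: direct_sum_def)
    have smult: "(c \<odot>\<^bsub>V\<^esub> v, c \<odot>\<^bsub>W\<^esub> w) \<in> N" if "c \<in> carrier K" "(v, w) \<in> N" for c v w
      using submodule.smult_closed[OF N(1) that] by (simp add: direct_sum_def)
    have zero: "(\<zero>\<^bsub>V\<^esub>, \<zero>\<^bsub>W\<^esub>) \<in> N"
      using submodule.zero_closed[OF N(1)] by (simp add: direct_sum_def)
    have "submodule K {v \<in> carrier V. (v, \<zero>\<^bsub>W\<^esub>) \<in> N} V"
    proof (rule submodule.intro, goal_cases)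
      case 1 show ?case by unfold_locales
    next
      case (3 v v') then show ?case using add[of v "\<zero>\<^bsub>W\<^esub>" v' "\<zero>\<^bsub>W\<^esub>"] by auto
    next
      case (5 c v) then show ?case using smult[of c v "\<zero>\<^bsub>W\<^esub>"] by auto
    qed (use zero in auto)
    then have 1: "(v, \<zero>\<^bsub>W\<^esub>) \<in> N" if "v \<in> carrier V" for v
      using A(2) A(3)[of "{v \<in> carrier V. (v, \<zero>\<^bsub>W\<^esub>) \<in> N}"] N(2) that by auto
    have "submodule K {w \<in> carrier W. (\<zero>\<^bsub>V\<^esub>, w) \<in> N} W"
    proof (rule submodule.intro, goal_cases)
      case 1 show ?case by unfold_locales
    next
      case (3 w w') then show ?case using add[of "\<zero>\<^bsub>V\<^esub>" w "\<zero>\<^bsub>V\<^esub>" w'] by auto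
    next
      case (5 c w) then show ?case using smult[of c "\<zero>\<^bsub>V\<^esub>" w] by auto
    qed (use zero in auto)
    then have 2: "(\<zero>\<^bsub>V\<^esub>, w) \<in> N" if "w \<in> carrier W" for w
      using B(2) B(3)[of "{w \<in> carrier W. (\<zero>\<^bsub>V\<^esub>, w) \<in> N}"] N(2) that by auto
    show ?thesis
    proof
      fix x assume "x \<in> carrier (direct_sum V W)"
      then obtain v w where "x = (v, w)" "v \<in> carrier V" "w \<in> carrier W"
        by (auto simp: direct_sum_def)
      then show "x \<in> N"
        using add[OF 1[of v] 2[of w]] by simp
    qed
  qed
  have S: "finite ?S" "?S \<subseteq> carrier (direct_sum V W)"
    using A(1,2) B(1,2) by (auto simp: direct_sum_def)
  show ?thesis
    unfolding fin_dim_iff_submodule[OF direct_sum_is_vs[OF V W]]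
    by (intro exI[of _ ?S] conjI allI impI S gen)
qed

lemma quadratic_space_diag:
  fixes as :: "'a::field list"
  shows "quadratic_space (diag as)"
proof -
  have vs: "vectorspace class_ring (module_vec TYPE('a) (length as))"
    by (rule vec_vs)
  have fd: "vectorspace.fin_dim class_ring (module_vec TYPE('a) (length as))"
    by (rule vec_space.fin_dim)
  have vsd: "vectorspace class_ring (diag as)"
    using vs by (simp add: diag_def vectorspace_extend_iff)
  interpret vectorspace class_ring "diag as" by (fact vsd)
  show ?thesis
  proof (unfold_locales, goal_cases)
    case 1
    then show ?case using fd by (simp add: diag_def fin_dim_extend_iff[OF vs])
  next
    case (2 v c)
    then show ?case
      by (simp add: diag_def module_vec_simps power_mult_distrib sum_distrib_left mult.left_commute)
  next
    case (3 u v w)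
    then show ?case
      by (simp add: diag_def module_vec_simps flip: sum_subtractf sum.distrib)
        (rule sum.cong, auto simp: power2_eq_square algebra_simps)
  next
    case (4 v w c)
    then show ?case
      by (simp add: diag_def module_vec_simps sum_distrib_left flip: sum_subtractf)
        (rule sum.cong, auto simp: power2_eq_square algebra_simps)
  qed
qed

lemma quadratic_space_orth_sum:
  assumes "quadratic_space V" and "quadratic_space W"
  shows "quadratic_space (V \<oplus>\<^sub>q W)"
proof -
  interpret V: quadratic_space V by (fact assms)
  interpret W: quadratic_space W by (fact assms)
  have vs: "vectorspace class_ring (direct_sum V W)"
    by (rule direct_sum_is_vs) unfold_locales
  have vsd: "vectorspace class_ring (V \<oplus>\<^sub>q W)"
    using vs by (simp add: orth_sum_def vectorspace_extend_iff)
  interpret vectorspace class_ring "V \<oplus>\<^sub>q W" by (fact vsd)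
  show ?thesis
  proof (unfold_locales, goal_cases)
    case 1
    have "vectorspace.fin_dim class_ring (direct_sum V W)"
      by (rule fin_dim_direct_sum[OF _ _ V.finite_dimensional W.finite_dimensional]) unfold_locales
    then show ?case by (simp add: orth_sum_def fin_dim_extend_iff[OF vs])
  next
    case (2 v c)
    then show ?case
      by (auto simp: orth_sum_def direct_sum_def V.form_smult W.form_smult algebra_simps)
  next
    case (3 u v w)
    obtain u1 u2 v1 v2 w1 w2 where uvw: "u = (u1, u2)" "v = (v1, v2)" "w = (w1, w2)"
      by (cases u, cases v, cases w)
    then have "u1 \<in> carrier V" "v1 \<in> carrier V" "w1 \<in> carrier V"
        and "u2 \<in> carrier W" "v2 \<in> carrier W" "w2 \<in> carrier W"
      using 3 by (simp_all add: orth_sum_def direct_sum_def)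
    from arg_cong2[where f = "(+)", OF V.polar_add[OF this(1-3)] W.polar_add[OF this(4-6)]]
    show ?case
      unfolding uvw by (simp add: orth_sum_def direct_sum_def algebra_simps)
  next
    case (4 v w c)
    obtain v1 v2 w1 w2 where vw: "v = (v1, v2)" "w = (w1, w2)"
      by (cases v, cases w)
    then have "v1 \<in> carrier V" "w1 \<in> carrier V" "v2 \<in> carrier W" "w2 \<in> carrier W"
      using 4 by (simp_all add: orth_sum_def direct_sum_def)
    from arg_cong2[where f = "(+)",
        OF V.polar_smult[OF this(1,2), of c] W.polar_smult[OF this(3,4), of c]]
    show ?case
      unfolding vw by (simp add: orth_sum_def direct_sum_def algebra_simps)
  qed
qed

end

theory Submission
  imports
    Defs
    "HOL-Combinatorics.List_Permutation"
    "HOL-Number_Theory.Euler_Criterion"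
begin

text \<open>
  Since p is congruent to 1 modulo 4, \<open>-1\<close> is a square in the p-adic integers, say
  \<open>\<iota>\<^sup>2 = -1\<close>. Hence \<open>a x\<^sup>2 + a y\<^sup>2 = a (x + \<iota> y) (x - \<iota> y)\<close> is a hyperbolic plane for every
  \<open>a \<noteq> 0\<close>, so two equal coefficients of a diagonal form may be replaced by any other two equal
  nonzero coefficients. On the other side the form \<open>diag(1, \<lambda>, p, \<lambda>p)\<close> is anisotropic: modulo p
  the form \<open>x\<^sup>2 + \<lambda>y\<^sup>2\<close> has no nontrivial zero, as \<open>-\<lambda>\<close> is a nonsquare, and an infinite descent
  does the rest. Thus a form with coefficients in \<open>C = {1, \<lambda>, p, \<lambda>p}\<close> is a sum of hyperbolic planes
  and of an anisotropic form that contains exactly the elements of C of odd multiplicity, once each.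

  All the equivalences are instances of one criterion (theorem \<open>diag_zeros_embeds_iff\<close>), valid over
  every field of characteristic other than 2 with a square root of \<open>-1\<close> and a finite set C of
  coefficients whose diagonal form is anisotropic. For lists S and V over C, let d be the number of
  elements of C that occur an odd number of times in S and V together. Then \<open>S \<oplus> 0\<^sup>k\<close> embeds in V if and
  only if \<open>length S + 2k + d \<le> length V\<close>.

  For sufficiency, enlarge S by k hyperbolic planes, which contain \<open>0\<^sup>k\<close>, by one copy of
  each of the d elements, and by further hyperbolic planes up to the dimension of V. The result has
  the dimension and the parities of V, so it is isometric to V.

  For necessity, \<open>S \<oplus> S\<close> contains the totally isotropic diagonal \<open>{(s, \<iota> s)}\<close>, so an embedding of
  \<open>S \<oplus> 0\<^sup>k\<close> in V makes \<open>V \<oplus> S\<close> contain a totally isotropic subspace of dimension \<open>length S + k\<close>.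
  Splitting off a hyperbolic plane lowers the dimension of such a subspace by at most one
  (lemma \<open>isotropic_family_remove_hyperbolic_plane\<close>), and an anisotropic form contains no nonzero
  isotropic vector. So twice the dimension is at most the dimension of \<open>V \<oplus> S\<close> minus d, which is
  the stated inequality. For the forms of the corollary it remains to count parities.
\<close>

section \<open>Embeddings between diagonal forms\<close>

lemma embedsI:
  assumes "\<And>v. v \<in> carrier V \<Longrightarrow> f v \<in> carrier W"
    and "\<And>u v. u \<in> carrier V \<Longrightarrow> v \<in> carrier V \<Longrightarrow> f (u \<oplus>\<^bsub>V\<^esub> v) = f u \<oplus>\<^bsub>W\<^esub> f v"
    and "\<And>c v. v \<in> carrier V \<Longrightarrow> f (c \<odot>\<^bsub>V\<^esub> v) = c \<odot>\<^bsub>W\<^esub> f v"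
    and "inj_on f (carrier V)"
    and "\<And>v. v \<in> carrier V \<Longrightarrow> form W (f v) = form V v"
  shows "V embeds_in W"
  unfolding embeds_def module_hom_def using assms by blast

lemma embeds_trans [trans]:
  assumes "U embeds_in V" and "V embeds_in W"
  shows "U embeds_in W"
proof -
  obtain f where f: "f \<in> module_hom class_ring U V" "inj_on f (carrier U)"
      "\<forall>v \<in> carrier U. form V (f v) = form U v"
    using assms(1) unfolding embeds_def by blast
  obtain g where g: "g \<in> module_hom class_ring V W" "inj_on g (carrier V)"
      "\<forall>v \<in> carrier V. form W (g v) = form V v"
    using assms(2) unfolding embeds_def by blast
  have "inj_on (g \<circ> f) (carrier U)"
    using f g by (auto intro!: comp_inj_on intro: inj_on_subset simp: module_hom_def)
  then show ?thesis
    using f g by (intro embedsI[where f = "g \<circ> f"]) (auto simp: module_hom_def Pi_iff class_ring_simps)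
qed

lemma diag_sel [simp]:
  fixes as :: "'a::field list"
  shows "carrier (diag as) = carrier_vec (length as)"
    and "add (diag as) = (+)"
    and "module.smult (diag as) = (\<cdot>\<^sub>v)"
    and "form (diag as) = (\<lambda>v. \<Sum>i<length as. as ! i * (v $ i)\<^sup>2)"
  by (simp_all add: diag_def module_vec_simps)

lemma orth_sum_sel [simp]:
  "carrier (V \<oplus>\<^sub>q W) = carrier V \<times> carrier W"
  "add (V \<oplus>\<^sub>q W) = (\<lambda>v w. (fst v \<oplus>\<^bsub>V\<^esub> fst w, snd v \<oplus>\<^bsub>W\<^esub> snd w))"
  "module.smult (V \<oplus>\<^sub>q W) = (\<lambda>c v. (c \<odot>\<^bsub>V\<^esub> fst v, c \<odot>\<^bsub>W\<^esub> snd v))"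
  "form (V \<oplus>\<^sub>q W) = (\<lambda>v. form V (fst v) + form W (snd v))"
  by (simp_all add: orth_sum_def direct_sum_def split_def)

lemma orth_sum_mono:
  assumes "V embeds_in V'" and "W embeds_in W'"
  shows "V \<oplus>\<^sub>q W embeds_in V' \<oplus>\<^sub>q W'"
proof -
  obtain f where f: "f \<in> module_hom class_ring V V'" "inj_on f (carrier V)"
      "\<forall>v \<in> carrier V. form V' (f v) = form V v"
    using assms(1) unfolding embeds_def by blast
  obtain g where g: "g \<in> module_hom class_ring W W'" "inj_on g (carrier W)"
      "\<forall>v \<in> carrier W. form W' (g v) = form W v"
    using assms(2) unfolding embeds_def by blast
  show ?thesis
    using f g by (intro embedsI[where f = "map_prod f g"])
      (auto simp: module_hom_def Pi_iff class_ring_simps map_prod_inj_on)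
qed

lemma sum_lessThan_add:
  fixes f :: "nat \<Rightarrow> 'a::comm_monoid_add"
  shows "(\<Sum>i<m + n. f i) = (\<Sum>i<m. f i) + (\<Sum>i<n. f (m + i))"
  by (induction n) (simp_all add: add.assoc)

lemma embeds_orth_sum_diag_append:
  fixes as bs :: "'a::field list"
  shows "diag (as @ bs) embeds_in diag as \<oplus>\<^sub>q diag bs"
proof (rule embedsI[where f = "\<lambda>v. (vec_first v (length as), vec_last v (length bs))"])
  show "inj_on (\<lambda>v. (vec_first v (length as), vec_last v (length bs))) (carrier (diag (as @ bs)))"
    by (rule inj_onI) (metis carrier_vec_dim_vec diag_sel(1) length_append prod.inject vec_first_last_append)
  fix v :: "'a vec" assume v: "v \<in> carrier (diag (as @ bs))"
  show "form (diag as \<oplus>\<^sub>q diag bs) (vec_first v (length as), vec_last v (length bs)) = form (diag (as @ bs)) v"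
    using v by (simp add: vec_first_def vec_last_def nth_append sum_lessThan_add)
qed (auto simp: vec_first_def vec_last_def intro!: eq_vecI)

lemma embeds_diag_append_orth_sum:
  fixes as bs :: "'a::field list"
  shows "diag as \<oplus>\<^sub>q diag bs embeds_in diag (as @ bs)"
proof (rule embedsI[where f = "\<lambda>(v, w). v @\<^sub>v w"])
  show "inj_on (\<lambda>(v, w). v @\<^sub>v w) (carrier (diag as \<oplus>\<^sub>q diag bs))"
    by (rule inj_onI) (auto simp: append_vec_eq)
qed (auto simp: sum_lessThan_add nth_append intro!: eq_vecI)

lemma diag_append_mono:
  fixes as :: "'a::field list"
  assumes "diag as embeds_in diag as'" and "diag bs embeds_in diag bs'"
  shows "diag (as @ bs) embeds_in diag (as' @ bs')"
  using embeds_orth_sum_diag_append orth_sum_mono[OF assms] embeds_diag_append_orth_sum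
  by (blast intro: embeds_trans)

text \<open>
  This turns embeddings of the spaces in question into a relation between lists of coefficients.
\<close>

lemma orth_sum_diag_embeds_iff:
  fixes as :: "'a::field list"
  shows "diag as \<oplus>\<^sub>q diag bs embeds_in V \<longleftrightarrow> diag (as @ bs) embeds_in V"
  using embeds_orth_sum_diag_append embeds_diag_append_orth_sum by (blast intro: embeds_trans)

lemma diag_embeds_if_mset_eq:
  fixes as bs :: "'a::field list"
  assumes "mset as = mset bs"
  shows "diag as embeds_in diag bs"
proof -
  obtain \<pi> where \<pi>: "\<pi> permutes {..<length as}" "permute_list \<pi> as = bs"
    using mset_eq_permutation[OF assms[symmetric]] by blast
  have len: "length bs = length as"
    using assms by (rule mset_eq_length[symmetric])
  have lt: "\<pi> i < length as" if "i < length as" for i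
    using permutes_in_image[OF \<pi>(1)] that by simp
  have nth: "bs ! i = as ! \<pi> i" if "i < length as" for i
    using permute_list_nth[OF \<pi>(1) that] \<pi>(2) by simp
  show ?thesis
  proof (rule embedsI[where f = "\<lambda>v. vec (length as) (\<lambda>i. v $ \<pi> i)"])
    show "inj_on (\<lambda>v. vec (length as) (\<lambda>i. v $ \<pi> i)) (carrier (diag as))"
    proof (rule inj_onI, rule eq_vecI)
      fix v w :: "'a vec" and i
      assume vw: "v \<in> carrier (diag as)" "w \<in> carrier (diag as)"
        and eq: "vec (length as) (\<lambda>i. v $ \<pi> i) = vec (length as) (\<lambda>i. w $ \<pi> i)"
        and "i < dim_vec w"
      then obtain j where "j < length as" "i = \<pi> j"
        using permutes_image[OF \<pi>(1)] by (auto simp: image_iff set_eq_iff)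
      then show "v $ i = w $ i"
        using arg_cong[OF eq, of "\<lambda>x. x $ j"] by simp
    qed auto
    fix v :: "'a vec"
    show "form (diag bs) (vec (length as) (\<lambda>i. v $ \<pi> i)) = form (diag as) v"
      using sum.permute[OF \<pi>(1), of "\<lambda>i. as ! i * (v $ i)\<^sup>2"]
      by (simp add: len nth)
  qed (auto simp: len lt intro!: eq_vecI)
qed

lemma diag_embeds_refl: "diag as embeds_in diag as"
  by (rule diag_embeds_if_mset_eq) simp

lemma diag_Nil_embeds: "diag [] embeds_in diag (as :: 'a::field list)"
  by (rule embedsI[where f = "\<lambda>_. 0\<^sub>v (length as)"]) (auto simp: inj_on_def intro!: eq_vecI)

lemma diag_embeds_append: "diag as embeds_in diag (as @ bs)"
  using diag_append_mono[OF diag_embeds_refl diag_Nil_embeds, of as bs] by simp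

text \<open>
  The vector \<open>(1, \<iota>)\<close> is isotropic.
\<close>

lemma zero_embeds_double:
  fixes a \<iota> :: "'a::field"
  assumes "\<iota>\<^sup>2 = -1"
  shows "diag [0] embeds_in diag [a, a]"
proof (rule embedsI[where f = "\<lambda>v. vec 2 (\<lambda>i. if i = 0 then v $ 0 else \<iota> * v $ 0)"])
  show "inj_on (\<lambda>v. vec 2 (\<lambda>i. if i = 0 then v $ 0 else \<iota> * v $ 0)) (carrier (diag [0::'a]))"
  proof (rule inj_onI)
    fix v w :: "'a vec"
    assume "v \<in> carrier (diag [0])" "w \<in> carrier (diag [0])"
      and eq: "vec 2 (\<lambda>i. if i = 0 then v $ 0 else \<iota> * v $ 0) =
          vec 2 (\<lambda>i. if i = 0 then w $ 0 else \<iota> * w $ 0)"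
    moreover have "v $ 0 = w $ 0"
      using arg_cong[OF eq, of "\<lambda>x. x $ 0"] by simp
    ultimately show "v = w"
      by (intro eq_vecI) auto
  qed
  fix v :: "'a vec"
  show "form (diag [a, a]) (vec 2 (\<lambda>i. if i = 0 then v $ 0 else \<iota> * v $ 0)) = form (diag [0]) v"
    by (simp add: power_mult_distrib assms)
qed (auto simp: distrib_left mult.left_commute intro!: eq_vecI)

text \<open>
  Both sides are hyperbolic planes. In the coordinates \<open>x + \<iota> y\<close> and \<open>x - \<iota> y\<close>, in which the
  forms are products, the isometry multiplies the first coordinate by \<open>a / b\<close> and fixes the second.
\<close>

lemma double_embeds_double:
  fixes a b \<iota> :: "'a::field"
  assumes \<iota>: "\<iota>\<^sup>2 = -1" and two: "(2::'a) \<noteq> 0" and nz: "a \<noteq> 0" "b \<noteq> 0"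
  shows "diag [a, a] embeds_in diag [b, b]"
proof -
  define c where "c = a / b"
  have c: "c \<noteq> 0" "b * c = a"
    using nz by (simp_all add: c_def)
  define f where "f v = vec 2 (\<lambda>i. if i = 0
      then inverse 2 * (c * (v $ 0 + \<iota> * v $ 1) + (v $ 0 - \<iota> * v $ 1))
      else inverse (2 * \<iota>) * (c * (v $ 0 + \<iota> * v $ 1) - (v $ 0 - \<iota> * v $ 1)))" for v :: "'a vec"
  have \<iota>0: "\<iota> \<noteq> 0"
    using \<iota> by auto
  have half: "2 * (inverse 2 * x) = x" "2 * (\<iota> * (inverse (2 * \<iota>) * x)) = x" for x
  proof -
    have "2 * \<iota> \<noteq> 0"
      using two \<iota>0 by simp
    then have "(2 * \<iota>) * inverse (2 * \<iota>) * x = x" "2 * inverse 2 * x = x"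
      using two by (simp_all only: right_inverse mult_1 not_False_eq_True)
    then show "2 * (inverse 2 * x) = x" "2 * (\<iota> * (inverse (2 * \<iota>) * x)) = x"
      by (simp_all only: mult.assoc)
  qed
  have f: "2 * f v $ 0 = c * (v $ 0 + \<iota> * v $ 1) + (v $ 0 - \<iota> * v $ 1)"
    "2 * (\<iota> * f v $ 1) = c * (v $ 0 + \<iota> * v $ 1) - (v $ 0 - \<iota> * v $ 1)" for v
  proof -
    have "f v $ 0 = inverse 2 * (c * (v $ 0 + \<iota> * v $ 1) + (v $ 0 - \<iota> * v $ 1))"
      "f v $ 1 = inverse (2 * \<iota>) * (c * (v $ 0 + \<iota> * v $ 1) - (v $ 0 - \<iota> * v $ 1))"
      by (simp_all add: f_def)
    then show "2 * f v $ 0 = c * (v $ 0 + \<iota> * v $ 1) + (v $ 0 - \<iota> * v $ 1)"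
      "2 * (\<iota> * f v $ 1) = c * (v $ 0 + \<iota> * v $ 1) - (v $ 0 - \<iota> * v $ 1)"
      by (simp_all only: half)
  qed
  have cancel: "x = y" if "2 * x = 2 * y" for x y :: 'a
    using that two by simp
  have plus: "f v $ 0 + \<iota> * f v $ 1 = c * (v $ 0 + \<iota> * v $ 1)" for v
    by (rule cancel) (simp only: distrib_left f, simp add: algebra_simps)
  have minus: "f v $ 0 - \<iota> * f v $ 1 = v $ 0 - \<iota> * v $ 1" for v
    by (rule cancel) (simp only: right_diff_distrib f, simp add: algebra_simps)
  show ?thesis
  proof (rule embedsI[where f = f])
    show "inj_on f (carrier (diag [a, a]))"
    proof (rule inj_onI)
      fix v w assume vw: "v \<in> carrier (diag [a, a])" "w \<in> carrier (diag [a, a])" and eq: "f v = f w"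
      have p: "v $ 0 + \<iota> * v $ 1 = w $ 0 + \<iota> * w $ 1"
        using plus[of v] plus[of w] eq c by simp
      have m: "v $ 0 - \<iota> * v $ 1 = w $ 0 - \<iota> * w $ 1"
        using minus[of v] minus[of w] eq by simp
      have "2 * v $ 0 = 2 * w $ 0" "2 * (\<iota> * v $ 1) = 2 * (\<iota> * w $ 1)"
        using arg_cong2[OF p m, of "(+)"] arg_cong2[OF p m, of "(-)"] by simp_all
      then have "v $ 0 = w $ 0" "v $ 1 = w $ 1"
        using two \<iota>0 by simp_all
      then show "v = w"
        using vw by (auto intro!: eq_vecI simp: less_Suc_eq numeral_2_eq_2)
    qed
    fix v assume v: "v \<in> carrier (diag [a, a])"
    have sq: "x\<^sup>2 + y\<^sup>2 = (x + \<iota> * y) * (x - \<iota> * y)" for x y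
    proof -
      have "(x + \<iota> * y) * (x - \<iota> * y) = x\<^sup>2 - \<iota>\<^sup>2 * y\<^sup>2"
        by (simp add: algebra_simps power2_eq_square)
      then show ?thesis
        by (simp add: \<iota>)
    qed
    have "b * ((f v $ 0)\<^sup>2 + (f v $ 1)\<^sup>2) = a * ((v $ 0)\<^sup>2 + (v $ 1)\<^sup>2)"
      by (simp only: sq plus minus c(2)[symmetric] mult.assoc)
    then show "form (diag [b, b]) (f v) = form (diag [a, a]) v"
      by (simp add: distrib_left)
  qed (auto simp: f_def less_Suc_eq algebra_simps intro!: eq_vecI)
qed

text \<open>
  The totally isotropic subspace here is the graph of multiplication by \<open>\<iota>\<close>.
\<close>

lemma replicate_zero_embeds:
  fixes \<iota> :: "'a::field" and as :: "'a list"
  assumes "\<iota>\<^sup>2 = -1"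
  shows "diag (replicate (length as) 0) embeds_in diag (as @ as)"
proof (induction as)
  case Nil
  show ?case by (simp add: diag_Nil_embeds)
next
  case (Cons a as)
  have "diag ([0] @ replicate (length as) 0) embeds_in diag ([a, a] @ (as @ as))"
    by (rule diag_append_mono[OF zero_embeds_double[OF assms] Cons.IH])
  moreover have "diag ([a, a] @ (as @ as)) embeds_in diag ((a # as) @ (a # as))"
    by (rule diag_embeds_if_mset_eq) simp
  ultimately show ?case
    using embeds_trans by fastforce
qed

text \<open>
  If one of the lists has distinct entries, then each multiplicity in it is 0 or 1 and has the parity
  of the multiplicity in the other list, so it does not exceed the latter, and equal lengths force
  equal multisets. Otherwise both lists contain a pair of equal entries, that is, a hyperbolic plane,
  and these planes can be split off.
\<close>

lemma diag_embeds_if_same_parity: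
  fixes \<iota> :: "'a::field" and as bs :: "'a list"
  assumes \<iota>: "\<iota>\<^sup>2 = -1" and two: "(2::'a) \<noteq> 0"
    and "0 \<notin> set as" and "0 \<notin> set bs" and "length as = length bs"
    and "\<And>a. even (count_list as a) \<longleftrightarrow> even (count_list bs a)"
  shows "diag as embeds_in diag bs"
  using assms(3-)
proof (induction "length as" arbitrary: as bs rule: less_induct)
  case less
  have sub: "mset xs = mset ys" if "distinct xs" "length xs = length ys"
      "\<And>a. even (count_list xs a) \<longleftrightarrow> even (count_list ys a)" for xs ys :: "'a list"
  proof -
    have "count_list xs a \<le> count_list ys a" for a
    proof (cases "a \<in> set xs")
      case True
      then have "count_list xs a = 1"
        using that(1) by (simp add: distinct_count_atmost_1 flip: count_mset)
      then have "odd (count_list ys a)"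
        using that(3)[of a] by simp
      then show ?thesis
        using \<open>count_list xs a = 1\<close> by (cases "count_list ys a") auto
    qed (simp add: count_list_0_iff)
    then have "mset xs \<subseteq># mset ys"
      by (simp add: mset_subset_eqI count_mset)
    then show ?thesis
      using that(2) mset_subset_size[of "mset xs" "mset ys"] by (auto simp: subset_mset.less_le)
  qed
  show ?case
  proof (cases "distinct as \<or> distinct bs")
    case True
    then have "mset as = mset bs"
      using sub[of as bs] sub[of bs as] less.prems by auto
    then show ?thesis
      by (rule diag_embeds_if_mset_eq)
  next
    case False
    have decomp: "\<exists>x ys. mset xs = mset ([x, x] @ ys)" if dup: "\<not> distinct xs" for xs :: "'a list"
    proof -
      obtain us x vs ws where "xs = us @ [x] @ vs @ [x] @ ws"
        using not_distinct_decomp[OF dup] by blast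
      then have "mset xs = mset ([x, x] @ (us @ vs @ ws))"
        by simp
      then show ?thesis
        by blast
    qed
    obtain a as' b bs' where as: "mset as = mset ([a, a] @ as')" and bs: "mset bs = mset ([b, b] @ bs')"
      using decomp[of as] decomp[of bs] False by blast
    have set: "set as = insert a (set as')" "set bs = insert b (set bs')"
      using mset_eq_setD[OF as] mset_eq_setD[OF bs] by auto
    have len: "length as = length as' + 2" "length bs = length bs' + 2"
      using mset_eq_length[OF as] mset_eq_length[OF bs] by auto
    have cnt: "even (count_list as x) \<longleftrightarrow> even (count_list as' x)"
        "even (count_list bs x) \<longleftrightarrow> even (count_list bs' x)" for x
      using as bs by (simp_all flip: count_mset)
    have "diag as' embeds_in diag bs'"
      using less.prems set len cnt by (intro less.hyps) auto
    moreover have "diag [a, a] embeds_in diag [b, b]"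
      using less.prems set by (intro double_embeds_double[OF \<iota> two]) auto
    ultimately have "diag ([a, a] @ as') embeds_in diag ([b, b] @ bs')"
      by (rule diag_append_mono[rotated])
    then show ?thesis
      using diag_embeds_if_mset_eq[OF as] diag_embeds_if_mset_eq[OF bs[symmetric]] embeds_trans by blast
  qed
qed

section \<open>Totally isotropic subspaces\<close>

text \<open>
  A totally isotropic subspace is given by a basis w of vectors indexed by J. The coordinates are
  indexed by a set I rather than by an initial segment of the naturals, so that a hyperbolic plane can
  be split off by deleting two indices.
\<close>

definition isotropic_family :: "('i \<Rightarrow> 'a::field) \<Rightarrow> 'i set \<Rightarrow> 'j set \<Rightarrow> ('j \<Rightarrow> 'i \<Rightarrow> 'a) \<Rightarrow> bool"
  where "isotropic_family c I J w \<longleftrightarrow>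
    (\<forall>j\<in>J. \<forall>k\<in>J. (\<Sum>i\<in>I. c i * w j i * w k i) = 0) \<and>
    (\<forall>a. (\<forall>i\<in>I. (\<Sum>j\<in>J. a j * w j i) = 0) \<longrightarrow> (\<forall>j\<in>J. a j = 0))"

lemma isotropic_family_of_embedding:
  fixes cs :: "'a::field list"
  assumes two: "(2::'a) \<noteq> 0" and emb: "diag (replicate l 0) embeds_in diag cs"
  shows "\<exists>w. isotropic_family (\<lambda>i. cs ! i) {..<length cs} {..<l} w"
proof -
  let ?n = "length cs"
  obtain f where "f \<in> module_hom class_ring (diag (replicate l 0)) (diag cs)"
    and inj: "inj_on f (carrier_vec l)"
    and form: "\<forall>v \<in> carrier_vec l. form (diag cs) (f v) = form (diag (replicate l 0)) v"
    using emb by (auto simp: embeds_def)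
  then have car: "\<And>v. v \<in> carrier_vec l \<Longrightarrow> f v \<in> carrier_vec ?n"
    and add: "\<And>u v. u \<in> carrier_vec l \<Longrightarrow> v \<in> carrier_vec l \<Longrightarrow> f (u + v) = f u + f v"
    and smult: "\<And>r v. v \<in> carrier_vec l \<Longrightarrow> f (r \<cdot>\<^sub>v v) = r \<cdot>\<^sub>v f v"
    by (auto simp: module_hom_def Pi_iff class_ring_simps)
  have iso: "(\<Sum>i<?n. cs ! i * (f v $ i)\<^sup>2) = 0" if "v \<in> carrier_vec l" for v
    using form that by simp
  have zero: "f (0\<^sub>v l) = 0\<^sub>v ?n"
  proof -
    have "0 \<cdot>\<^sub>v 0\<^sub>v l = (0\<^sub>v l :: 'a vec)"
      by auto
    then have "f (0\<^sub>v l) = 0 \<cdot>\<^sub>v f (0\<^sub>v l)"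
      using smult[of "0\<^sub>v l" 0] by simp
    also have "\<dots> = 0\<^sub>v ?n"
      using car[of "0\<^sub>v l"] by (intro eq_vecI) auto
    finally show ?thesis .
  qed
  define w where "w j i = f (unit_vec l j) $ i" for j i
  have expand: "f (vec l (\<lambda>j. if j < m then a j else 0)) $ i = (\<Sum>j<m. a j * w j i)"
    if "i < ?n" "m \<le> l" for a m i
    using that(2)
  proof (induction m)
    case 0
    have "vec l (\<lambda>j. 0) = (0\<^sub>v l :: 'a vec)"
      by auto
    then show ?case
      using that zero by simp
  next
    case (Suc m)
    have "vec l (\<lambda>j. if j < Suc m then a j else 0) =
        vec l (\<lambda>j. if j < m then a j else 0) + a m \<cdot>\<^sub>v unit_vec l m"
      by (rule eq_vecI) (use Suc.prems in \<open>auto simp: less_Suc_eq\<close>)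
    then show ?case
      using Suc that(1) car[of "unit_vec l m"] car[of "vec l (\<lambda>j. if j < m then a j else 0)"]
      by (simp add: add smult w_def)
  qed
  have expand: "f (vec l a) $ i = (\<Sum>j<l. a j * w j i)" if "i < ?n" for a i
  proof -
    have "vec l (\<lambda>j. if j < l then a j else 0) = vec l a"
      by auto
    then show ?thesis
      using expand[OF that order_refl, of a] by simp
  qed
  have orth: "(\<Sum>i<?n. cs ! i * w j i * w k i) = 0" for j k
  proof -
    let ?u = "unit_vec l j" and ?v = "unit_vec l k"
    have "(\<Sum>i<?n. cs ! i * (f (?u + ?v) $ i)\<^sup>2) =
        (\<Sum>i<?n. cs ! i * (f ?u $ i)\<^sup>2 + cs ! i * (f ?v $ i)\<^sup>2 + 2 * (cs ! i * w j i * w k i))"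
      using car[of ?u] car[of ?v]
      by (intro sum.cong) (simp_all add: add w_def power2_eq_square algebra_simps)
    then have "2 * (\<Sum>i<?n. cs ! i * w j i * w k i) = 0"
      by (simp add: iso sum.distrib flip: sum_distrib_left)
    then show ?thesis
      using two by simp
  qed
  have indep: "a j = 0" if "\<forall>i\<in>{..<?n}. (\<Sum>j<l. a j * w j i) = 0" "j \<in> {..<l}" for a j
  proof -
    have "f (vec l a) = f (0\<^sub>v l)"
      unfolding zero using that(1) expand car[of "vec l a"] by (auto intro!: eq_vecI)
    then have "vec l a = 0\<^sub>v l"
      using inj by (auto dest: inj_onD)
    then have "vec l a $ j = 0\<^sub>v l $ j"
      by (rule arg_cong)
    then show ?thesis
      using that(2) by simp
  qed
  show ?thesis
    unfolding isotropic_family_def using indep by (intro exI[of _ w] conjI ballI allI impI orth) blast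
qed

text \<open>
  On the plane with coordinates \<open>i0\<close> and \<open>i1\<close> put \<open>y(f) = f i0 + \<iota> * f i1\<close>. On vectors with
  \<open>y = 0\<close> the plane does not contribute to the bilinear form, so the projection of such vectors to the
  remaining coordinates preserves the form. Only vectors on the isotropic line \<open>y = 0\<close> of the plane
  lie in its kernel.

  If y does not vanish on the family, subtracting multiples of some \<open>w j0\<close> with \<open>y (w j0) \<noteq> 0\<close> makes
  it vanish on the others. The projection is then injective on their span, because a nonzero vector of
  the isotropic line is not orthogonal to \<open>w j0\<close>. If y vanishes on the whole family, the projection has
  a kernel of dimension at most one, and omitting one vector that occurs in a relation suffices.
\<close>

lemma isotropic_family_remove_hyperbolic_plane:
  fixes c :: "'i \<Rightarrow> 'a::field" and \<iota> :: 'a and w :: "'j \<Rightarrow> 'i \<Rightarrow> 'a"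
  assumes fin: "finite I" "finite J" and \<iota>: "\<iota>\<^sup>2 = -1"
    and i: "i0 \<in> I" "i1 \<in> I" "i0 \<noteq> i1" and c: "c i0 = c i1" "c i1 \<noteq> 0"
    and w: "isotropic_family c I J w"
  obtains J' :: "'j set" and w' where "finite J'" and "card J \<le> card J' + 1" and "isotropic_family c (I - {i0, i1}) J' w'"
proof -
  define I' where "I' = I - {i0, i1}"
  define B where "B f g = (\<Sum>i\<in>I. c i * f i * g i)" for f g :: "'i \<Rightarrow> 'a"
  define y where "y f = f i0 + \<iota> * f i1" for f :: "'i \<Rightarrow> 'a"
  have \<iota>0: "\<iota> \<noteq> 0" and \<iota>\<iota>: "\<iota> * \<iota> = -1"
    using \<iota> by (auto simp: power2_eq_square)
  have split: "B f g = c i1 * (f i0 * g i0 + f i1 * g i1) + (\<Sum>i\<in>I'. c i * f i * g i)" for f g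
  proof -
    have "B f g = c i0 * f i0 * g i0 + (\<Sum>i\<in>I - {i0}. c i * f i * g i)"
      unfolding B_def using fin i by (intro sum.remove) auto
    also have "(\<Sum>i\<in>I - {i0}. c i * f i * g i) =
        c i1 * f i1 * g i1 + (\<Sum>i\<in>I - {i0} - {i1}. c i * f i * g i)"
      using fin i by (intro sum.remove) auto
    also have "I - {i0} - {i1} = I'"
      by (auto simp: I'_def)
    finally show ?thesis
      by (simp add: c algebra_simps)
  qed
  have y0: "f i0 = - \<iota> * f i1" if "y f = 0" for f
    using that by (simp add: y_def eq_neg_iff_add_eq_0)
  have BI': "(\<Sum>i\<in>I'. c i * f i * g i) = 0" if "y f = 0" "y g = 0" "B f g = 0" for f g
  proof -
    have "f i0 * g i0 + f i1 * g i1 = (\<iota> * \<iota>) * (f i1 * g i1) + f i1 * g i1"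
      by (simp add: y0 that)
    then show ?thesis
      using split[of f g] that(3) \<iota>\<iota> by simp
  qed
  have iso: "B (w j) (w k) = 0" if "j \<in> J" "k \<in> J" for j k
    using w that unfolding isotropic_family_def B_def by blast
  have indep: "\<forall>j\<in>J. a j = 0" if "\<forall>i\<in>I. (\<Sum>j\<in>J. a j * w j i) = 0" for a
    using w that unfolding isotropic_family_def by blast
  show thesis
  proof (cases "\<exists>j\<in>J. y (w j) \<noteq> 0")
    case True
    then obtain j0 where j0: "j0 \<in> J" "y (w j0) \<noteq> 0" by blast
    define r where "r j = y (w j) / y (w j0)" for j
    define w' where "w' j i = w j i - r j * w j0 i" for j i
    have yw': "y (w' j) = 0" for j
    proof -
      have "y (w' j) = y (w j) - r j * y (w j0)"
        by (simp add: y_def w'_def algebra_simps)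
      then show ?thesis
        using j0 by (simp add: r_def)
    qed
    have Bw': "B (w' j) g = B (w j) g - r j * B (w j0) g" for j g
      unfolding B_def w'_def sum_distrib_left sum_subtractf[symmetric]
      by (intro sum.cong) (simp_all add: algebra_simps)
    have Bsym: "B f g = B g f" for f g
      by (simp add: B_def mult.commute mult.left_commute)
    have "(\<Sum>i\<in>I'. c i * w' j i * w' k i) = 0" if "j \<in> J" "k \<in> J" for j k
    proof (rule BI'[OF yw' yw'])
      show "B (w' j) (w' k) = 0"
        using that j0 by (simp add: Bw'[of j] Bsym[of "w j" "w' k"] Bsym[of "w j0" "w' k"] Bw'[of k] iso)
    qed
    moreover have "a j = 0"
      if a: "\<forall>i\<in>I'. (\<Sum>j\<in>J - {j0}. a j * w' j i) = 0" and j: "j \<in> J - {j0}" for a j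
    proof -
      define z where "z i = (\<Sum>j\<in>J - {j0}. a j * w' j i)" for i
      have yz: "y z = 0"
      proof -
        have "y z = (\<Sum>j\<in>J - {j0}. a j * y (w' j))"
          by (simp add: y_def z_def sum_distrib_left sum.distrib algebra_simps)
        then show ?thesis
          by (simp add: yw')
      qed
      have "B z (w j0) = (\<Sum>j\<in>J - {j0}. a j * B (w' j) (w j0))"
        unfolding B_def z_def sum_distrib_left sum_distrib_right
        by (subst sum.swap) (simp add: mult_ac)
      also have "\<dots> = 0"
        using j0 by (intro sum.neutral) (simp add: Bw' iso)
      finally have "B z (w j0) = 0" .
      moreover have "(\<Sum>i\<in>I'. c i * z i * w j0 i) = 0"
        using a by (simp add: z_def)
      ultimately have "z i0 * w j0 i0 + z i1 * w j0 i1 = 0"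
        using split[of z "w j0"] c by simp
      moreover have "z i0 * w j0 i0 + z i1 * w j0 i1 = - \<iota> * z i1 * y (w j0)"
      proof -
        have "- \<iota> * z i1 * y (w j0) = - \<iota> * z i1 * w j0 i0 - (\<iota> * \<iota>) * (z i1 * w j0 i1)"
          by (simp add: y_def algebra_simps)
        then show ?thesis
          by (simp add: y0[OF yz] \<iota>\<iota>)
      qed
      ultimately have "z i1 = 0"
        using j0 \<iota>0 by simp
      then have "z i0 = 0"
        using y0[OF yz] by simp
      then have z: "z i = 0" if "i \<in> I" for i
        using \<open>z i1 = 0\<close> a that by (cases "i \<in> I'") (auto simp: I'_def z_def)
      \<comment> \<open>The relation among the vectors \<open>w' j\<close>, rewritten as a relation in the original family.\<close>
      define a' where "a' j = (if j = j0 then - (\<Sum>j\<in>J - {j0}. a j * r j) else a j)" for j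
      have "(\<Sum>j\<in>J. a' j * w j i) = z i" for i
      proof -
        have "(\<Sum>j\<in>J. a' j * w j i) = a' j0 * w j0 i + (\<Sum>j\<in>J - {j0}. a j * w j i)"
          using fin j0 by (simp add: sum.remove[of J j0] a'_def)
        also have "\<dots> = z i"
          by (simp add: z_def w'_def a'_def right_diff_distrib sum_subtractf sum_distrib_right mult.assoc)
        finally show ?thesis .
      qed
      then have "\<forall>j\<in>J. a' j = 0"
        using z by (intro indep) simp
      then show ?thesis
        using j by (auto simp: a'_def)
    qed
    ultimately have "isotropic_family c I' (J - {j0}) w'"
      unfolding isotropic_family_def by blast
    then show thesis
      using that[of "J - {j0}" w'] fin j0 by (simp add: I'_def)
  next
    case False
    then have yw: "y (w j) = 0" if "j \<in> J" for j
      using that by blast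
    have iso': "(\<Sum>i\<in>I'. c i * w j i * w k i) = 0" if "j \<in> J" "k \<in> J" for j k
      using that by (intro BI' yw iso)
    have ysum: "(\<Sum>j\<in>J. a j * w j i0) = - \<iota> * (\<Sum>j\<in>J. a j * w j i1)" for a
      by (simp add: sum_distrib_left y0[OF yw] mult_ac cong: sum.cong)
    show thesis
    proof (cases "isotropic_family c I' J w")
      case True
      then show thesis
        using that[of J w] fin by (simp add: I'_def)
    next
      case False
      then obtain a j0 where a: "\<forall>i\<in>I'. (\<Sum>j\<in>J. a j * w j i) = 0" and j0: "j0 \<in> J" "a j0 \<noteq> 0"
        unfolding isotropic_family_def using iso' by blast
      define A where "A = (\<Sum>j\<in>J. a j * w j i1)"
      have "A \<noteq> 0"
      proof
        assume "A = 0"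
        then have "\<forall>i\<in>I. (\<Sum>j\<in>J. a j * w j i) = 0"
          using a ysum[of a] by (auto simp: A_def I'_def)
        then show False
          using indep[of a] j0 by blast
      qed
      have "b j = 0"
        if b: "\<forall>i\<in>I'. (\<Sum>j\<in>J - {j0}. b j * w j i) = 0" and j: "j \<in> J - {j0}" for b j
      proof -
        define b' where "b' = b(j0 := 0)"
        have b': "(\<Sum>j\<in>J. b' j * w j i) = (\<Sum>j\<in>J - {j0}. b j * w j i)" for i
          using fin j0 by (simp add: sum.remove[of J j0] b'_def)
        define D where "D = (\<Sum>j\<in>J. b' j * w j i1)"
        \<comment> \<open>This combination vanishes at \<open>i1\<close> by the choice of A and D, and then at \<open>i0\<close> by \<open>ysum\<close>.\<close>
        have comb: "(\<Sum>j\<in>J. (A * b' j - D * a j) * w j i) =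
            A * (\<Sum>j\<in>J. b' j * w j i) - D * (\<Sum>j\<in>J. a j * w j i)" for i
          by (simp add: left_diff_distrib sum_subtractf sum_distrib_left mult.assoc)
        have "(\<Sum>j\<in>J. (A * b' j - D * a j) * w j i) = 0" if "i \<in> I" for i
        proof -
          consider "i \<in> I'" | "i = i0" | "i = i1"
            using \<open>i \<in> I\<close> by (auto simp: I'_def)
          then show ?thesis
          proof cases
            case 1
            then show ?thesis using a b by (simp add: comb b')
          next
            case 2
            then show ?thesis
              by (simp add: comb ysum) (simp add: A_def D_def)
          next
            case 3
            then show ?thesis
              by (simp add: comb) (simp add: A_def D_def)
          qed
        qed
        then have all: "A * b' j - D * a j = 0" if "j \<in> J" for j
          using indep[of "\<lambda>j. A * b' j - D * a j"] that by blast
        then have "D = 0"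
          using all[OF j0(1)] j0(2) by (simp add: b'_def)
        then show ?thesis
          using all[of j] j \<open>A \<noteq> 0\<close> by (simp add: b'_def)
      qed
      then have "isotropic_family c I' (J - {j0}) w"
        unfolding isotropic_family_def using iso' by blast
      then show thesis
        using that[of "J - {j0}" w] fin j0 by (simp add: I'_def)
    qed
  qed
qed

section \<open>A criterion over fields with anisotropic coefficients\<close>

text \<open>
  The instance in mind is \<open>\<rat>\<^sub>p\<close> with p congruent to 1 modulo 4, where C represents the square
  classes. Anisotropy forces different elements a and b of C to lie in different square classes: if
  \<open>b = a s\<^sup>2\<close>, then \<open>a (s \<iota>)\<^sup>2 + b = 0\<close>.
\<close>

locale anisotropic_classes =
  fixes \<iota> :: "'a::field" and C :: "'a set"
  assumes \<iota>: "\<iota>\<^sup>2 = -1" and two_nonzero: "(2::'a) \<noteq> 0" and finite_C: "finite C"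
    and anisotropic: "\<And>x. (\<Sum>a\<in>C. a * (x a)\<^sup>2) = 0 \<Longrightarrow> \<forall>a\<in>C. x a = 0"
begin

lemma zero_notin_C: "0 \<notin> C"
proof
  assume "0 \<in> C"
  have "(\<Sum>a\<in>C. a * (if a = 0 then 1 else 0)\<^sup>2) = (0::'a)"
    by (intro sum.neutral) auto
  from anisotropic[OF this] \<open>0 \<in> C\<close> show False
    by auto
qed

text \<open>
  As long as two coefficients agree, their plane is split off, which decreases the number of
  coordinates by two and the size of the family by at most one, and preserves all parities. The form
  that remains has distinct coefficients in C and so contains no isotropic vector.
\<close>

lemma isotropic_family_bound:
  fixes J :: "'j set"
  assumes "finite I" "finite J" "c ` I \<subseteq> C" "isotropic_family c I J w"
  shows "2 * card J + (\<Sum>a\<in>C. card {i \<in> I. c i = a} mod 2) \<le> card I"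
  using assms
proof (induction "card I" arbitrary: I J w rule: less_induct)
  case less
  show ?case
  proof (cases "inj_on c I")
    case True
    have "w j i = 0" if j: "j \<in> J" and i: "i \<in> I" for j i
    proof -
      define x where "x a = (if a \<in> c ` I then w j (inv_into I c a) else 0)" for a
      have x: "x (c i) = w j i" if "i \<in> I" for i
        using that True by (simp add: x_def)
      have "(\<Sum>a\<in>C. a * (x a)\<^sup>2) = (\<Sum>a\<in>c ` I. a * (x a)\<^sup>2)"
        using less.prems(3) finite_C by (intro sum.mono_neutral_right) (auto simp: x_def)
      also have "\<dots> = (\<Sum>i\<in>I. c i * w j i * w j i)"
        using True by (simp add: sum.reindex x power2_eq_square mult.assoc)
      also have "\<dots> = 0"
        using less.prems(4) j unfolding isotropic_family_def by blast
      finally have "\<forall>a\<in>C. x a = 0"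
        by (rule anisotropic)
      moreover have "c i \<in> C"
        using i less.prems(3) by blast
      ultimately show ?thesis
        using x[OF i] by metis
    qed
    then have "\<forall>i\<in>I. (\<Sum>j\<in>J. 1 * w j i) = 0"
      by (intro ballI sum.neutral) simp
    then have "\<forall>j\<in>J. (1::'a) = 0"
      using less.prems(4) unfolding isotropic_family_def by (elim conjE allE[of _ "\<lambda>_. 1"]) auto
    then have "J = {}"
      by auto
    have "card {i \<in> I. c i = a} mod 2 = (if a \<in> c ` I then 1 else 0)" for a
    proof (cases "a \<in> c ` I")
      case True
      then obtain i where "i \<in> I" "a = c i" by blast
      then have "{i \<in> I. c i = a} = {i}"
        using \<open>inj_on c I\<close> by (auto dest: inj_onD)
      then show ?thesis using True by simp
    next
      case False
      then have "{i \<in> I. c i = a} = {}" by auto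
      then show ?thesis using False by (simp only: card.empty mod_0 if_False)
    qed
    then have "(\<Sum>a\<in>C. card {i \<in> I. c i = a} mod 2) = card (C \<inter> c ` I)"
      by (simp only: card_eq_sum sum.inter_restrict[OF finite_C])
    also have "C \<inter> c ` I = c ` I"
      using less.prems(3) by auto
    finally show ?thesis
      using \<open>J = {}\<close> True by (simp add: card_image)
  next
    case False
    then obtain i0 i1 where i: "i0 \<in> I" "i1 \<in> I" "i0 \<noteq> i1" "c i0 = c i1"
      unfolding inj_on_def by blast
    have "c i1 \<noteq> 0"
      using i less.prems(3) zero_notin_C by auto
    then obtain J' :: "'j set" and w' where J': "finite J'" "card J \<le> card J' + 1"
        and w': "isotropic_family c (I - {i0, i1}) J' w'"
      by (rule isotropic_family_remove_hyperbolic_plane[OF less.prems(1,2) \<iota> i _ less.prems(4)])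
    let ?I = "I - {i0, i1}"
    have card: "card I = card ?I + 2"
      using i less.prems(1) card_Diff_subset[of "{i0, i1}" I] card_mono[of I "{i0, i1}"] by simp
    have "card {i \<in> ?I. c i = a} mod 2 = card {i \<in> I. c i = a} mod 2" for a
    proof (cases "a = c i1")
      case True
      then have "{i \<in> I. c i = a} = insert i0 (insert i1 {i \<in> ?I. c i = a})"
        using i by auto
      then show ?thesis
        using i(3) less.prems(1) by simp
    next
      case False
      then have "{i \<in> I. c i = a} = {i \<in> ?I. c i = a}"
        using i by auto
      then show ?thesis by simp
    qed
    moreover have "2 * card J' + (\<Sum>a\<in>C. card {i \<in> ?I. c i = a} mod 2) \<le> card ?I"
      using less.prems J' w' card by (intro less.hyps) auto
    ultimately show ?thesis
      using J'(2) card by simp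
  qed
qed

lemma diag_replicate_zero_embeds_bound:
  assumes "set cs \<subseteq> C" and "diag (replicate l 0) embeds_in diag cs"
  shows "2 * l + (\<Sum>a\<in>C. count_list cs a mod 2) \<le> length cs"
proof -
  obtain w where w: "isotropic_family (\<lambda>i. cs ! i) {..<length cs} {..<l} w"
    using isotropic_family_of_embedding[OF two_nonzero assms(2)] by blast
  have "count_list cs a = card {i \<in> {..<length cs}. cs ! i = a}" for a
    by (simp add: count_list_eq_length_filter length_filter_conv_card eq_commute[of a])
  moreover have "(\<lambda>i. cs ! i) ` {..<length cs} \<subseteq> C"
    using assms(1) by auto
  ultimately show ?thesis
    using isotropic_family_bound[OF _ _ _ w] by simp
qed

text \<open>
  Write S and V for the forms with coefficients \<open>as\<close> and \<open>cs\<close>. The forms S and \<open>-S\<close> are isometric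
  because \<open>-1\<close> is a square, so an orthogonal complement of S in V has the Witt class of \<open>S \<oplus> V\<close>. The
  sum of parities is the anisotropic dimension of this class, and the inequality says that a form in
  this class of dimension \<open>length cs - length as\<close> has Witt index at least k.
\<close>

theorem diag_zeros_embeds_iff:
  assumes as: "set as \<subseteq> C" and cs: "set cs \<subseteq> C"
  shows "diag as \<oplus>\<^sub>q diag (replicate k 0) embeds_in diag cs \<longleftrightarrow>
    length as + 2 * k + (\<Sum>a\<in>C. (count_list as a + count_list cs a) mod 2) \<le> length cs"
    (is "_ \<longleftrightarrow> length as + 2 * k + ?d \<le> length cs")
proof
  assume "diag as \<oplus>\<^sub>q diag (replicate k 0) embeds_in diag cs"
  then have emb: "diag (as @ replicate k 0) embeds_in diag cs"
    by (rule iffD1[OF orth_sum_diag_embeds_iff])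
  have "diag (replicate (length as) 0 @ replicate k 0) embeds_in diag ((as @ as) @ replicate k 0)"
    by (intro diag_append_mono replicate_zero_embeds[OF \<iota>] diag_embeds_refl)
  also have "diag ((as @ as) @ replicate k 0) embeds_in diag ((as @ replicate k 0) @ as)"
    by (rule diag_embeds_if_mset_eq) simp
  also have "diag ((as @ replicate k 0) @ as) embeds_in diag (cs @ as)"
    by (intro diag_append_mono emb diag_embeds_refl)
  finally have "diag (replicate (length as + k) 0) embeds_in diag (cs @ as)"
    by (simp only: replicate_add)
  then have "2 * (length as + k) + ?d \<le> length (cs @ as)"
    using diag_replicate_zero_embeds_bound[of "cs @ as" "length as + k"] as cs by (simp add: add.commute)
  then show "length as + 2 * k + ?d \<le> length cs"
    by simp
next
  assume le: "length as + 2 * k + ?d \<le> length cs"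
  define Odd where "Odd = {a \<in> C. odd (count_list as a + count_list cs a)}"
  have "finite Odd"
    using finite_C by (simp add: Odd_def)
  then obtain os where os: "set os = Odd" "distinct os"
    using finite_distinct_list by blast
  have cnt: "count_list os a = (if a \<in> Odd then 1 else 0)" for a
    using os by (simp add: distinct_count_atmost_1 flip: count_mset)
  have "?d = (\<Sum>a\<in>C. if a \<in> Odd then 1 else 0)"
    by (intro sum.cong) (simp_all add: Odd_def mod2_eq_if)
  also have "\<dots> = card (C \<inter> Odd)"
    by (simp only: card_eq_sum sum.inter_restrict[OF finite_C])
  also have "C \<inter> Odd = Odd"
    by (auto simp: Odd_def)
  finally have d: "?d = length os"
    using os distinct_card[of os] by simp
  have total: "(\<Sum>a\<in>C. count_list as a + count_list cs a) = length as + length cs"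
    using as cs finite_C by (simp add: sum.distrib sum_count_set)
  have "length os mod 2 = (length as + length cs) mod 2"
    unfolding d[symmetric] total[symmetric] by (rule mod_sum_eq)
  then have parity: "even (length os) \<longleftrightarrow> even (length as + length cs)"
    by (simp only: even_iff_mod_2_eq_zero)
  \<comment> \<open>The room left in \<open>cs\<close> has even dimension, so it can be filled with hyperbolic planes.\<close>
  obtain q where q: "length cs = length as + 2 * k + length os + q"
    using le unfolding d by (metis le_Suc_ex)
  have "even q"
    using parity unfolding q by auto
  then obtain h where h: "q = 2 * h"
    by blast
  have "diag (as @ replicate k 0) embeds_in diag (as @ (replicate k 1 @ replicate k 1))"
    using replicate_zero_embeds[OF \<iota>, of "replicate k 1"] by (intro diag_append_mono diag_embeds_refl) simp
  also have "diag (as @ (replicate k 1 @ replicate k 1)) embeds_in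
      diag ((as @ (replicate k 1 @ replicate k 1)) @ (replicate (2 * h) 1 @ os))"
    by (rule diag_embeds_append)
  also have "diag ((as @ (replicate k 1 @ replicate k 1)) @ (replicate (2 * h) 1 @ os)) embeds_in diag cs"
  proof (rule diag_embeds_if_same_parity[OF \<iota> two_nonzero])
    show "0 \<notin> set cs" "0 \<notin> set ((as @ (replicate k 1 @ replicate k 1)) @ (replicate (2 * h) 1 @ os))"
      using as cs os(1) zero_notin_C by (auto simp: Odd_def)
    show "length ((as @ (replicate k 1 @ replicate k 1)) @ (replicate (2 * h) 1 @ os)) = length cs"
      using q h by simp
    have one: "even (count_list (replicate k 1 @ replicate k 1) a)" "even (count_list (replicate (2 * h) 1) a)" for a :: 'a
      by (simp_all flip: count_mset)
    have "count_list as a = 0" "count_list cs a = 0" if "a \<notin> C" for a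
      using that as cs by (auto simp: count_list_0_iff)
    then have "even (count_list as a + count_list cs a + count_list os a)" for a
      by (cases "a \<in> C") (auto simp: cnt Odd_def)
    then show "even (count_list ((as @ (replicate k 1 @ replicate k 1)) @ (replicate (2 * h) 1 @ os)) a)
        \<longleftrightarrow> even (count_list cs a)" for a
      using one[of a] by (auto simp: count_list_append)
  qed
  finally show "diag as \<oplus>\<^sub>q diag (replicate k 0) embeds_in diag cs"
    by (rule iffD2[OF orth_sum_diag_embeds_iff])
qed

end

section \<open>A square root of -1 in the p-adic integers\<close>

lemma padic_component_mod:
  fixes x :: "'p::prime_card padic_int"
  assumes "m \<le> n"
  shows "padic_component x n mod int CARD('p) ^ m = padic_component x m"
  using padic_component[of x] assms by blast

lemma padic_component_eq_0_iff:
  fixes x :: "'p::prime_card padic_int"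
  assumes "m \<le> n"
  shows "padic_component x m = 0 \<longleftrightarrow> int CARD('p) ^ m dvd padic_component x n"
  using padic_component_mod[OF assms, of x] by (simp add: dvd_eq_mod_eq_0)

lemma padic_component_of_nat:
  "padic_component (of_nat k :: 'p::prime_card padic_int) n = int k mod int CARD('p) ^ n"
  by (induction k) (simp_all add: zero_padic_int.rep_eq one_padic_int.rep_eq plus_padic_int.rep_eq mod_simps)

lemma QuadRes_iff_padic_reduce_square:
  fixes u :: "'p::prime_card padic_int"
  shows "QuadRes (int CARD('p)) (padic_component u 1) \<longleftrightarrow> (\<exists>y. y\<^sup>2 = padic_reduce u)"
proof -
  have eq: "(of_int a = (of_int b :: 'p mod_ring)) \<longleftrightarrow> [a = b] (mod int CARD('p))" for a b
    unfolding of_int_of_int_mod_ring cong_def by transfer simp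
  have "(\<exists>y. y\<^sup>2 = padic_reduce u) \<longleftrightarrow> (\<exists>t::int. (of_int t)\<^sup>2 = padic_reduce u)"
    by (metis of_int_of_int_mod_ring of_int_mod_ring_to_int_mod_ring)
  then show ?thesis
    by (simp add: QuadRes_def padic_reduce_def eq flip: of_int_power)
qed

lemma not_dvd_if_not_QuadRes:
  fixes a m :: int
  assumes "\<not> QuadRes m a"
  shows "\<not> m dvd a"
proof
  assume "m dvd a"
  then have "[0\<^sup>2 = a] (mod m)"
    by (simp add: cong_sym_eq[of 0] cong_0_iff)
  then show False
    using assms unfolding QuadRes_def by blast
qed

text \<open>
  The fourth power of this number is 1 modulo \<open>p ^ n\<close> by Euler's theorem, while by Euler's criterion
  its square is \<open>-1\<close>, and hence not 1, modulo p. So in \<open>b ^ 4 - 1 = (b\<^sup>2 - 1) (b\<^sup>2 + 1)\<close> the first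
  factor is prime to p. The factor \<open>p ^ n\<close> in the exponent makes these numbers converge p-adically.
\<close>

lemma nonresidue_power_squared_cong_minus_one:
  fixes a :: nat and p :: nat
  assumes p: "prime p" and p4: "[p = 1] (mod 4)"
    and nonres: "\<not> QuadRes (int p) (int a)"
  shows "[(int a ^ ((p - 1) div 4 * p ^ n))\<^sup>2 = -1] (mod int p ^ n)"
proof (cases n)
  case (Suc m)
  have p_mod: "p mod 4 = 1"
    using p4 by (simp add: cong_def)
  moreover have "p \<noteq> 1" using p by auto
  ultimately have "2 < p" by (cases "p = 2") (auto simp: prime_gt_1_nat[OF p] intro: le_neq_trans prime_ge_2_nat[OF p])
  have ndvd: "\<not> p dvd a"
    using not_dvd_if_not_QuadRes[OF nonres] by simp
  let ?b = "int a ^ ((p - 1) div 4 * p ^ n)"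
  have half: "(p - 1) div 2 = (p - 1) div 4 * 2" and four: "p - 1 = (p - 1) div 4 * 4"
    using p_mod by presburger+
  have "[Legendre (int a) (int p) = int a ^ ((p - 1) div 2)] (mod int p)"
    using euler_criterion[of p "int a"] p \<open>2 < p\<close> by simp
  moreover have "Legendre (int a) (int p) = -1"
    using nonres ndvd by (simp add: Legendre_def cong_0_iff)
  ultimately have crit: "[int a ^ ((p - 1) div 2) = -1] (mod int p)"
    by (simp add: cong_sym_eq)
  have "?b\<^sup>2 = (int a ^ ((p - 1) div 2)) ^ (p ^ n)"
    unfolding half by (simp add: power_mult[symmetric] mult_ac)
  moreover have "odd (p ^ n)"
    using p_mod by (simp only: even_power) presburger
  ultimately have sq: "[?b\<^sup>2 = -1] (mod int p)"
    using cong_pow[OF crit, of "p ^ n"] by simp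
  have "coprime a (p ^ n)"
    using ndvd p by (metis coprime_commute coprime_power_right_iff prime_imp_coprime)
  then have "[a ^ totient (p ^ n) = 1] (mod p ^ n)"
    by (rule euler_theorem)
  then have "[(a ^ totient (p ^ n)) ^ p = 1 ^ p] (mod p ^ n)"
    by (rule cong_pow)
  moreover have "totient (p ^ n) * p = (p - 1) div 4 * p ^ n * 4"
  proof -
    have "totient (p ^ n) * p = (p - 1) * (p ^ m * p)"
      by (simp only: Suc totient_prime_power_Suc[OF p] mult_ac)
    also have "\<dots> = (p - 1) div 4 * 4 * (p ^ m * p)"
      using four by simp
    finally show ?thesis
      by (simp only: Suc power_Suc2 mult_ac)
  qed
  ultimately have "[a ^ ((p - 1) div 4 * p ^ n * 4) = 1] (mod p ^ n)"
    by (simp add: power_mult[symmetric])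
  then have "[int (a ^ ((p - 1) div 4 * p ^ n * 4)) = int 1] (mod int (p ^ n))"
    by (simp only: cong_int_iff)
  then have "[?b ^ 4 = 1] (mod int p ^ n)"
    by (simp add: power_mult)
  then have "int p ^ n dvd ?b ^ 4 - 1"
    by (simp add: cong_iff_dvd_diff)
  also have "?b ^ 4 - 1 = (?b\<^sup>2 - 1) * (?b\<^sup>2 + 1)"
    by (simp add: algebra_simps flip: power_add power_mult)
  finally have dvd: "int p ^ n dvd (?b\<^sup>2 - 1) * (?b\<^sup>2 + 1)" .
  have "\<not> int p dvd ?b\<^sup>2 - 1"
  proof
    assume "int p dvd ?b\<^sup>2 - 1"
    moreover have "int p dvd ?b\<^sup>2 + 1"
      using sq by (simp add: cong_iff_dvd_diff)
    ultimately have "int p dvd (?b\<^sup>2 + 1) - (?b\<^sup>2 - 1)"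
      by (rule dvd_diff[rotated])
    then have "int p dvd 2" by simp
    then show False using \<open>2 < p\<close> by (auto dest: zdvd_imp_le)
  qed
  then have "coprime (int p ^ n) (?b\<^sup>2 - 1)"
    using p by (simp add: prime_imp_coprime)
  then have "int p ^ n dvd ?b\<^sup>2 + 1"
    using dvd by (simp add: coprime_dvd_mult_right_iff)
  then show ?thesis
    by (simp add: cong_iff_dvd_diff)
qed simp

text \<open>
  The square root is the limit of the powers \<open>a ^ ((p - 1) div 4 * p ^ n)\<close>, where a is a quadratic
  nonresidue, here a representative of the reduction of u.
\<close>

lemma exists_padic_sqrt_minus_one:
  assumes p4: "[CARD('p) = 1] (mod 4)"
    and nonres: "\<nexists>y. y\<^sup>2 = padic_reduce (u :: 'p::prime_card padic_int)"
  shows "\<exists>\<iota> :: 'p padic_int. \<iota>\<^sup>2 = -1"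
proof -
  let ?p = "CARD('p)"
  define a where "a = nat (padic_component u 1)"
  have p: "prime ?p" by (rule prime_card)
  have "0 \<le> padic_component u 1"
    using padic_component_mod[of 1 1 u] by (metis order_refl pos_mod_sign power_one_right of_nat_0_less_iff prime_gt_0_nat[OF p])
  then have a: "\<not> QuadRes (int ?p) (int a)"
    using nonres QuadRes_iff_padic_reduce_square[of u] by (simp add: a_def)
  have ndvd: "\<not> ?p dvd a"
    using not_dvd_if_not_QuadRes[OF a] by simp
  define e where "e n = (?p - 1) div 4 * ?p ^ n" for n
  have step: "[a ^ e (Suc n) = a ^ e n] (mod ?p ^ n)" for n
  proof (cases n)
    case (Suc m)
    have "e (Suc n) = e n + (?p - 1) div 4 * (?p ^ n * (?p - 1))"
      using prime_gt_0_nat[OF p] by (simp add: e_def algebra_simps)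
    also have "\<dots> = e n + totient (?p ^ n) * (?p * ((?p - 1) div 4))"
      unfolding Suc totient_prime_power_Suc[OF p] by (simp only: power_Suc mult_ac)
    finally have eq: "a ^ e (Suc n) = a ^ e n * (a ^ totient (?p ^ n)) ^ (?p * ((?p - 1) div 4))"
      by (simp add: power_add power_mult)
    have "coprime a (?p ^ n)"
      using ndvd p by (metis coprime_commute coprime_power_right_iff prime_imp_coprime)
    then have "[a ^ totient (?p ^ n) = 1] (mod ?p ^ n)"
      by (rule euler_theorem)
    then have "[a ^ e n * (a ^ totient (?p ^ n)) ^ (?p * ((?p - 1) div 4)) =
        a ^ e n * 1 ^ (?p * ((?p - 1) div 4))] (mod ?p ^ n)"
      by (intro cong_mult cong_pow cong_refl)
    then show ?thesis
      unfolding eq by simp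
  qed simp
  have compat: "[a ^ e n = a ^ e m] (mod ?p ^ m)" if "m \<le> n" for m n
    using that
  proof (induction n rule: dec_induct)
    case (step n)
    have "[a ^ e (Suc n) = a ^ e n] (mod ?p ^ m)"
      using \<open>[a ^ e (Suc n) = a ^ e n] (mod ?p ^ n)\<close> step.hyps(1) le_imp_power_dvd cong_dvd_modulus_nat by blast
    then show ?case using step.IH cong_trans by blast
  qed simp
  define x where "x n = int (a ^ e n) mod int ?p ^ n" for n
  have x: "x n mod int ?p ^ m = x m" if "m \<le> n" for m n
  proof -
    have "[int (a ^ e n) = int (a ^ e m)] (mod int (?p ^ m))"
      using compat[OF that] by (simp only: cong_int_iff)
    then show ?thesis
      unfolding x_def mod_power_mod_power[OF that] by (simp add: cong_def)
  qed
  define \<iota> where "\<iota> = (Abs_padic_int x :: 'p padic_int)"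
  have comp: "padic_component \<iota> = x"
    unfolding \<iota>_def using x by (intro Abs_padic_int_inverse) blast
  have "padic_component (\<iota>\<^sup>2) n = padic_component (-1 :: 'p padic_int) n" for n
  proof -
    have "[(int a ^ e n)\<^sup>2 = -1] (mod int ?p ^ n)"
      unfolding e_def using nonresidue_power_squared_cong_minus_one[OF p p4 a] .
    then show ?thesis
      by (simp add: comp x_def power2_eq_square times_padic_int.rep_eq uminus_padic_int.rep_eq
          one_padic_int.rep_eq mod_simps cong_def)
  qed
  then have "\<iota>\<^sup>2 = -1"
    by (auto simp: padic_component_inject[symmetric])
  then show ?thesis ..
qed

section \<open>Anisotropy over the p-adic numbers\<close>

text \<open>
  This is the descent, carried out on integer representatives. A zero modulo \<open>p\<^sup>2\<close> forces p to divide
  x and y, as \<open>-u\<close> is a nonresidue, and then also z and w after one factor p is cancelled.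
  Dividing all four by p lowers the modulus by \<open>p\<^sup>2\<close>.
\<close>

lemma anisotropic_mod_prime_power:
  fixes p u x y z w :: int
  assumes p: "prime p" and i: "[i\<^sup>2 = -1] (mod p)" and u: "\<not> QuadRes p u"
    and "p ^ (2 * n) dvd x\<^sup>2 + u * y\<^sup>2 + p * (z\<^sup>2 + u * w\<^sup>2)"
  shows "p ^ n dvd x \<and> p ^ n dvd y \<and> p ^ n dvd z \<and> p ^ n dvd w"
  using assms(4)
proof (induction n arbitrary: x y z w)
  case (Suc n)
  have aniso: "p dvd s \<and> p dvd t" if "p dvd s\<^sup>2 + u * t\<^sup>2" for s t
  proof -
    have "p dvd t"
    proof (rule ccontr)
      assume "\<not> p dvd t"
      then have "coprime t p"
        using p prime_imp_coprime coprime_commute by blast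
      then obtain t' where t': "[t * t' = 1] (mod p)"
        using cong_solve_coprime_int by blast
      have "[s\<^sup>2 + u * t\<^sup>2 = 0] (mod p)"
        using that by (simp add: cong_0_iff)
      then have "[(s\<^sup>2 + u * t\<^sup>2) * t'\<^sup>2 = 0 * t'\<^sup>2] (mod p)"
        by (intro cong_mult cong_refl)
      moreover have "(s\<^sup>2 + u * t\<^sup>2) * t'\<^sup>2 = (s * t')\<^sup>2 + u * (t * t')\<^sup>2"
        by (simp add: algebra_simps power2_eq_square)
      moreover have "[(s * t')\<^sup>2 + u * (t * t')\<^sup>2 = (s * t')\<^sup>2 + u * 1\<^sup>2] (mod p)"
        using t' by (intro cong_add cong_mult cong_pow cong_refl)
      ultimately have "[(s * t')\<^sup>2 + u = 0] (mod p)"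
        by (simp add: cong_def)
      then have "[- (s * t')\<^sup>2 = u] (mod p)"
        by (simp add: cong_iff_dvd_diff) (metis add.inverse_inverse dvd_minus_iff minus_add_distrib add.commute diff_conv_add_uminus)
      moreover have "[i\<^sup>2 * (s * t')\<^sup>2 = -1 * (s * t')\<^sup>2] (mod p)"
        by (intro cong_mult i cong_refl)
      ultimately have "[(i * (s * t'))\<^sup>2 = u] (mod p)"
        by (simp add: power_mult_distrib cong_def)
      then show False
        using u unfolding QuadRes_def by blast
    qed
    then have "p dvd u * t\<^sup>2"
      by (simp add: power2_eq_square)
    then have "p dvd s\<^sup>2"
      using that by (simp add: dvd_add_left_iff)
    then show ?thesis
      using p \<open>p dvd t\<close> by (simp add: prime_dvd_power_iff)
  qed
  let ?q = "x\<^sup>2 + u * y\<^sup>2 + p * (z\<^sup>2 + u * w\<^sup>2)"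
  have p0: "p \<noteq> 0" using p by auto
  have q: "p\<^sup>2 * p ^ (2 * n) dvd ?q"
    using Suc.prems by (simp add: power2_eq_square mult.assoc)
  then have "p dvd ?q"
    by (metis dvd_mult_left power2_eq_square)
  then have "p dvd x\<^sup>2 + u * y\<^sup>2"
    by (simp add: dvd_add_left_iff)
  then obtain x' y' where xy: "x = p * x'" "y = p * y'"
    using aniso by (metis dvdE)
  have eq: "?q = p * (p * (x'\<^sup>2 + u * y'\<^sup>2) + (z\<^sup>2 + u * w\<^sup>2))"
    unfolding xy by (simp add: algebra_simps power2_eq_square)
  have "p * (p * p ^ (2 * n)) dvd p * (p * (x'\<^sup>2 + u * y'\<^sup>2) + (z\<^sup>2 + u * w\<^sup>2))"
    using q unfolding eq by (simp add: power2_eq_square mult.assoc)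
  then have q': "p * p ^ (2 * n) dvd p * (x'\<^sup>2 + u * y'\<^sup>2) + (z\<^sup>2 + u * w\<^sup>2)"
    using p0 by (simp only: dvd_mult_cancel_left) simp
  then have "p dvd z\<^sup>2 + u * w\<^sup>2"
    by (metis dvd_add_right_iff dvd_mult_left dvd_triv_left)
  then obtain z' w' where zw: "z = p * z'" "w = p * w'"
    using aniso by (metis dvdE)
  have eq': "p * (x'\<^sup>2 + u * y'\<^sup>2) + (z\<^sup>2 + u * w\<^sup>2) = p * (x'\<^sup>2 + u * y'\<^sup>2 + p * (z'\<^sup>2 + u * w'\<^sup>2))"
    unfolding zw by (simp add: algebra_simps power2_eq_square)
  have "p ^ (2 * n) dvd x'\<^sup>2 + u * y'\<^sup>2 + p * (z'\<^sup>2 + u * w'\<^sup>2)"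
    using q' p0 unfolding eq' by (simp only: dvd_mult_cancel_left) simp
  then show ?case
    using Suc.IH unfolding xy zw by simp
qed simp

text \<open>
  Applying the descent to the components modulo \<open>p ^ (2 * n)\<close> shows that the components modulo
  \<open>p ^ n\<close> of all four numbers vanish.
\<close>

lemma padic_int_anisotropic:
  fixes \<iota> u x y z w :: "'p::prime_card padic_int"
  assumes \<iota>: "\<iota>\<^sup>2 = -1" and nonres: "\<nexists>y. y\<^sup>2 = padic_reduce u"
    and eq: "x\<^sup>2 + u * y\<^sup>2 + of_nat CARD('p) * (z\<^sup>2 + u * w\<^sup>2) = 0"
  shows "x = 0 \<and> y = 0 \<and> z = 0 \<and> w = 0"
proof -
  let ?p = "int CARD('p)"
  have "padic_component x n = 0 \<and> padic_component y n = 0 \<and> padic_component z n = 0 \<and> padic_component w n = 0" for n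
  proof (cases "n = 0")
    case True
    then show ?thesis
      by (simp add: padic_component_eq_0_iff[of 0 0])
  next
    case False
    let ?c = "\<lambda>t :: 'p padic_int. padic_component t (2 * n)"
    have "padic_component (\<iota>\<^sup>2) 1 = padic_component (-1 :: 'p padic_int) 1"
      by (simp add: \<iota>)
    then have i: "[(padic_component \<iota> 1)\<^sup>2 = -1] (mod ?p)"
      by (simp add: power2_eq_square times_padic_int.rep_eq uminus_padic_int.rep_eq one_padic_int.rep_eq
          mod_simps cong_def)
    have "[padic_component u 1 = ?c u] (mod ?p)"
      using padic_component_mod[of 1 "2 * n" u] padic_component_mod[of 1 1 u] False by (simp add: cong_def)
    then have nonres': "\<not> QuadRes ?p (?c u)"
      using nonres unfolding QuadRes_iff_padic_reduce_square[symmetric] QuadRes_def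
      by (meson cong_sym cong_trans)
    have "?c (x\<^sup>2 + u * y\<^sup>2 + of_nat CARD('p) * (z\<^sup>2 + u * w\<^sup>2)) = 0"
      by (simp add: eq zero_padic_int.rep_eq)
    then have "?p ^ (2 * n) dvd (?c x)\<^sup>2 + ?c u * (?c y)\<^sup>2 + ?p * ((?c z)\<^sup>2 + ?c u * (?c w)\<^sup>2)"
      by (simp add: power2_eq_square times_padic_int.rep_eq plus_padic_int.rep_eq padic_component_of_nat
          mod_simps dvd_eq_mod_eq_0)
    from anisotropic_mod_prime_power[OF prime_card_int i nonres' this] show ?thesis
      by (simp add: padic_component_eq_0_iff[of n "2 * n"])
  qed
  then show ?thesis
    by (simp add: padic_component_inject[symmetric] zero_padic_int.rep_eq fun_eq_iff)
qed

lemma common_denominator: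
  fixes A :: "'a::idom fract set"
  assumes "finite A"
  shows "\<exists>d. d \<noteq> 0 \<and> (\<forall>x\<in>A. \<exists>a. to_fract d * x = to_fract a)"
  using assms
proof induction
  case (insert x A)
  then obtain d where d: "d \<noteq> 0" "\<forall>y\<in>A. \<exists>a. to_fract d * y = to_fract a"
    by blast
  obtain a b where x: "x = Fract a b" and b: "b \<noteq> 0"
    by (cases x) auto
  have "\<exists>c. to_fract (b * d) * y = to_fract c" if y: "y \<in> insert x A" for y
  proof (cases "y = x")
    case True
    have "to_fract (b * d) * x = to_fract (a * d)"
      using b by (simp add: x Fract_conv_to_fract)
    then show ?thesis
      using True by blast
  next
    case False
    then obtain c where "to_fract d * y = to_fract c"
      using y d(2) by blast
    then have "to_fract (b * d) * y = to_fract (b * c)"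
      by (simp add: mult.assoc)
    then show ?thesis by blast
  qed
  then show ?case
    using b d by (intro exI[of _ "b * d"]) simp
qed (auto intro: exI[of _ 1])

lemma padic_anisotropic:
  fixes \<iota> u :: "'p::prime_card padic_int" and x y z w :: "'p padic"
  assumes \<iota>: "\<iota>\<^sup>2 = -1" and nonres: "\<nexists>y. y\<^sup>2 = padic_reduce u"
    and eq: "x\<^sup>2 + to_fract u * y\<^sup>2 + of_nat CARD('p) * (z\<^sup>2 + to_fract u * w\<^sup>2) = 0"
  shows "x = 0 \<and> y = 0 \<and> z = 0 \<and> w = 0"
proof -
  obtain d where d: "d \<noteq> 0" "\<forall>t\<in>{x, y, z, w}. \<exists>a. to_fract d * t = to_fract a"
    using common_denominator[of "{x, y, z, w}"] by auto
  then obtain a b c e where abce: "to_fract d * x = to_fract a" "to_fract d * y = to_fract b"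
      "to_fract d * z = to_fract c" "to_fract d * w = to_fract e"
    by auto
  have of_nat: "to_fract (of_nat m) = (of_nat m :: 'p padic)" for m
    by (induction m) simp_all
  have "to_fract (a\<^sup>2 + u * b\<^sup>2 + of_nat CARD('p) * (c\<^sup>2 + u * e\<^sup>2)) =
      (to_fract d * x)\<^sup>2 + to_fract u * (to_fract d * y)\<^sup>2 +
      of_nat CARD('p) * ((to_fract d * z)\<^sup>2 + to_fract u * (to_fract d * w)\<^sup>2)"
    unfolding abce by (simp add: of_nat power2_eq_square)
  also have "\<dots> = (to_fract d)\<^sup>2 * (x\<^sup>2 + to_fract u * y\<^sup>2 + of_nat CARD('p) * (z\<^sup>2 + to_fract u * w\<^sup>2))"
    by (simp add: power_mult_distrib algebra_simps)
  also have "\<dots> = 0"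
    by (simp only: eq mult_zero_right)
  finally have "a\<^sup>2 + u * b\<^sup>2 + of_nat CARD('p) * (c\<^sup>2 + u * e\<^sup>2) = 0"
    by (simp only: to_fract_eq_0_iff)
  from padic_int_anisotropic[OF \<iota> nonres this] have "to_fract d * x = 0" "to_fract d * y = 0" "to_fract d * z = 0" "to_fract d * w = 0"
    by (simp_all add: abce)
  then show ?thesis
    using d(1) by simp
qed

lemma padic_two_nonzero:
  assumes "2 < CARD('p)"
  shows "(2 :: 'p::prime_card padic) \<noteq> 0"
proof -
  have "padic_component (of_nat 2 :: 'p padic_int) 1 \<noteq> 0"
    unfolding padic_component_of_nat using assms by simp
  then have "(2 :: 'p padic_int) \<noteq> 0"
    by (auto simp: zero_padic_int.rep_eq)
  then have "to_fract (2 :: 'p padic_int) \<noteq> 0"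
    by simp
  also have "to_fract (2 :: 'p padic_int) = 2"
    by (metis one_add_one to_fract_1 to_fract_add)
  finally show ?thesis .
qed

section \<open>Embeddings into diag(1, ..., 1, lambda)\<close>

theorem corollary18:
  fixes p n k :: nat and u :: "'p::prime_card padic_int" and lam :: "'p padic"
  assumes "CARD('p) = p" and "[p = 1] (mod 4)"
    and "u dvd 1" and "\<nexists>y. y\<^sup>2 = padic_reduce u" and "lam = to_fract u"
    and "n \<ge> 1"
  shows
    "(diag [lam] \<oplus>\<^sub>q diag (replicate k 0) embeds_in diag (replicate (n - 1) 1 @ [lam])
        \<longleftrightarrow> real k \<le> (real n - 1) / 2) \<and>
     (\<forall>S \<in> {diag [1], diag [1, lam]}.
        S \<oplus>\<^sub>q diag (replicate k 0) embeds_in diag (replicate (n - 1) 1 @ [lam])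
        \<longleftrightarrow> real k \<le> (real n - 2) / 2) \<and>
     (\<forall>S \<in> {diag [of_nat p], diag [lam * of_nat p], diag [1, 1], diag [lam, of_nat p],
          diag [lam, lam * of_nat p], diag [1, 1, lam]}.
        S \<oplus>\<^sub>q diag (replicate k 0) embeds_in diag (replicate (n - 1) 1 @ [lam])
        \<longleftrightarrow> real k \<le> (real n - 3) / 2) \<and>
     (\<forall>S \<in> {diag [1, of_nat p], diag [1, lam * of_nat p], diag [1, 1, 1],
          diag [1, lam, of_nat p], diag [1, lam, lam * of_nat p]}.
        S \<oplus>\<^sub>q diag (replicate k 0) embeds_in diag (replicate (n - 1) 1 @ [lam])
        \<longleftrightarrow> real k \<le> (real n - 4) / 2) \<and>
     (\<forall>S \<in> {diag [of_nat p, lam * of_nat p], diag [1, 1, of_nat p],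
          diag [1, 1, lam * of_nat p], diag [lam, of_nat p, lam * of_nat p]}.
        S \<oplus>\<^sub>q diag (replicate k 0) embeds_in diag (replicate (n - 1) 1 @ [lam])
        \<longleftrightarrow> real k \<le> (real n - 5) / 2) \<and>
     (diag [1, of_nat p, lam * of_nat p] \<oplus>\<^sub>q diag (replicate k 0)
          embeds_in diag (replicate (n - 1) 1 @ [lam])
        \<longleftrightarrow> real k \<le> (real n - 6) / 2)"
proof -
  obtain \<iota> :: "'p padic_int" where \<iota>: "\<iota>\<^sup>2 = -1"
    using exists_padic_sqrt_minus_one assms(1,2,4) by blast
  define j where "j = to_fract \<iota>"
  have j: "j\<^sup>2 = -1"
    unfolding j_def by (metis \<iota> power2_eq_square to_fract_1 to_fract_mult to_fract_uminus)
  define q where "q = (of_nat p :: 'p padic)"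
  have aniso: "x = 0 \<and> y = 0 \<and> z = 0 \<and> w = 0"
    if "x\<^sup>2 + lam * y\<^sup>2 + q * (z\<^sup>2 + lam * w\<^sup>2) = 0" for x y z w
    using padic_anisotropic[OF \<iota> assms(4), of x y z w] that assms(1,5) by (simp add: q_def)
  \<comment> \<open>Two equal coefficients would give the isotropic vector \<open>(1, j)\<close>.\<close>
  have distinct: "lam \<noteq> 1" "q \<noteq> 1" "lam * q \<noteq> 1" "q \<noteq> lam" "lam * q \<noteq> lam" "lam * q \<noteq> q"
  proof -
    show "lam \<noteq> 1" using aniso[of 1 j 0 0] by (auto simp: j)
    show "q \<noteq> 1" using aniso[of 1 0 j 0] by (auto simp: j)
    show "lam * q \<noteq> 1" using aniso[of 1 0 0 j] by (auto simp: j mult.commute)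
    show "q \<noteq> lam" using aniso[of 0 1 j 0] by (auto simp: j)
    show "lam * q \<noteq> lam" using aniso[of 0 1 0 j] by (auto simp: j mult.commute)
    show "lam * q \<noteq> q" using aniso[of 0 0 1 j] by (auto simp: j right_diff_distrib mult.commute)
  qed
  have nonzero: "lam \<noteq> 0" "q \<noteq> 0"
    using aniso[of 0 1 0 0] aniso[of 0 0 1 0] by auto
  define C where "C = {1, lam, q, lam * q}"
  have sum_C: "(\<Sum>a\<in>C. f a) = f 1 + f lam + f q + f (lam * q)" for f :: "'p padic \<Rightarrow> 'b::comm_monoid_add"
    unfolding C_def using distinct distinct[symmetric] by (simp add: add.assoc)
  have "2 < p"
    using assms(1,2) prime_card[where 'a = 'p] prime_ge_2_nat[of p] by (cases "p = 2") (auto simp: cong_def)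
  interpret anisotropic_classes j C
  proof
    show "(2 :: 'p padic) \<noteq> 0"
      using padic_two_nonzero \<open>2 < p\<close> assms(1) by blast
    show "\<forall>a\<in>C. x a = 0" if "(\<Sum>a\<in>C. a * (x a)\<^sup>2) = 0" for x
      using that aniso[of "x 1" "x lam" "x q" "x (lam * q)"] unfolding sum_C
      by (simp add: C_def algebra_simps)
  qed (simp_all add: j C_def)
  obtain m where m: "n = Suc m"
    using assms(6) by (cases n) auto
  have key: "diag as \<oplus>\<^sub>q diag (replicate k 0) embeds_in diag (replicate m 1 @ [lam]) \<longleftrightarrow>
      length as + 2 * k + (count_list as 1 + m) mod 2 + (count_list as lam + 1) mod 2 +
        count_list as q mod 2 + count_list as (lam * q) mod 2 \<le> Suc m"
    if "set as \<subseteq> C" for as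
  proof -
    have "set (replicate m 1 @ [lam]) \<subseteq> C"
      by (auto simp: C_def)
    moreover have "count_list (replicate m 1 @ [lam]) a = (if a = 1 then m else 0) + (if a = lam then 1 else 0)" for a
      by (simp flip: count_mset)
    ultimately show ?thesis
      using diag_zeros_embeds_iff[OF that, of "replicate m 1 @ [lam]" k] distinct
      by (simp add: sum_C add.assoc)
  qed
  have "real k \<le> (real n - real c) / 2 \<longleftrightarrow> 2 * k + c \<le> n" for c
    unfolding of_nat_le_iff[of "2 * k + c" n, where 'a = real, symmetric] by auto
  from this[of 1] this[of 2] this[of 3] this[of 4] this[of 5] this[of 6]
  have real_le: "real k \<le> (real n - 1) / 2 \<longleftrightarrow> 2 * k + 1 \<le> n" "real k \<le> (real n - 2) / 2 \<longleftrightarrow> 2 * k + 2 \<le> n"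
    "real k \<le> (real n - 3) / 2 \<longleftrightarrow> 2 * k + 3 \<le> n" "real k \<le> (real n - 4) / 2 \<longleftrightarrow> 2 * k + 4 \<le> n"
    "real k \<le> (real n - 5) / 2 \<longleftrightarrow> 2 * k + 5 \<le> n" "real k \<le> (real n - 6) / 2 \<longleftrightarrow> 2 * k + 6 \<le> n"
    by simp_all
  have in_C: "1 \<in> C" "lam \<in> C" "q \<in> C" "lam * q \<in> C"
    by (simp_all add: C_def)
  \<comment> \<open>The sides of each inequality on the left have the same parity, because the dimensions of a form
    and of its anisotropic part do; hence a summand that is at most 1 can be dropped.\<close>
  have parity: "2 * k + m mod 2 \<le> m \<longleftrightarrow> 2 * k \<le> m"
      "Suc (2 * k + Suc m mod 2) \<le> m \<longleftrightarrow> Suc (2 * k) \<le> m"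
      "Suc (Suc (2 * k + m mod 2)) \<le> m \<longleftrightarrow> Suc (Suc (2 * k)) \<le> m"
      "Suc (Suc (Suc (2 * k + Suc m mod 2))) \<le> m \<longleftrightarrow> 3 + 2 * k \<le> m"
      "Suc (Suc (Suc (Suc (2 * k + m mod 2)))) \<le> m \<longleftrightarrow> 4 + 2 * k \<le> m"
      "Suc (Suc (Suc (Suc (Suc (2 * k + Suc m mod 2))))) \<le> m \<longleftrightarrow> 5 + 2 * k \<le> m"
    by presburger+
  show ?thesis
    unfolding real_le unfolding q_def[symmetric] m diff_Suc_1
    by (simp add: key in_C distinct distinct[symmetric] nonzero parity)
qed

end
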